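(* Let $\sigma\colon\mathbb{R}\to\mathbb{R}$ be a bounded measurable function, and let $u$ be a nonnegative local minimizer in $B_1\subset\mathbb{R}^n$ of the functional $$\mathcal{J}(v,B_1)=\int_{B_1}\tfrac12|Dv|^2+\sigma(v)\,dx .$$ Let $x_0\in\partial\{u>0\}\cap B_{1/2}$. Then $$|u(x)|\le C\left(\|u\|_{L^\infty(B_{3/4})}+\sqrt{\|\sigma\|_{L^\infty(\mathbb{R})}}\,\right)|x-x_0|,\qquad x\in B_{1/4}(x_0),$$ for some universal constant $C>0$.
   Context: $B_r(x_0)$ is the open ball in $\mathbb{R}^n$ of radius $r$ and center $x_0$, and $B_r=B_r(0)$. For an open set $\Omega'\subset B_1$ write $\mathcal{J}(v,\Omega')=\int_{\Omega'}\frac12|Dv|^2+\sigma(v)\,dx$. A function $u\in H^1(B_1)$ is a local minimizer of $\mathcal{J}$ in $B_1$ if, for every open $\Omega'\subset B_1$, $\mathcal{J}(u,\Omega')\le\mathcal{J}(v,\Omega')$ for all $v\in H^1(\Omega')$ with $v-u\in H^1_0(\Omega')$. The minimization setting also fixes a bounded nonnegative boundary datum $\varphi\in H^1\cap L^\infty$ of the minimization problem. A constant is called universal if it depends only on the data: the dimension $n$, the $L^\infty$-norm of $\sigma$, and the boundary datum $\varphi$. Local minimizers are identified with their continuous representatives.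
   Formalization: The norm of σ is the supremum of |σ| over all of ℝ rather than the essential supremum, with which the estimate fails (n=1, σ=−K at 0 and at t, zero elsewhere); σ is taken Borel measurable so that σ(v) is measurable. *)

theory Defs
  imports "HOL-Probability.Essential_Supremum"
begin

text \<open>Functions on an open set \<open>\<Omega>\<close> are represented by total functions on \<open>real ^ 'n\<close>; every notion
  below depends only on the values on \<open>\<Omega>\<close>.\<close>

definition partial_deriv :: "'n::finite \<Rightarrow> (real ^ 'n \<Rightarrow> real) \<Rightarrow> real ^ 'n \<Rightarrow> real" where
  "partial_deriv i f x = frechet_derivative f (at x) (axis i 1)"

fun Ck :: "nat \<Rightarrow> (real ^ 'n::finite \<Rightarrow> real) \<Rightarrow> bool" where
  "Ck 0 f \<longleftrightarrow> continuous_on UNIV f"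
| "Ck (Suc k) f \<longleftrightarrow> (\<forall>x. f differentiable (at x)) \<and> (\<forall>i. Ck k (partial_deriv i f))"

definition test_functions :: "(real ^ 'n::finite) set \<Rightarrow> (real ^ 'n \<Rightarrow> real) set" where
  "test_functions \<Omega> =
     {\<psi>. (\<forall>k. Ck k \<psi>) \<and> compact (closure {x. \<psi> x \<noteq> 0}) \<and> closure {x. \<psi> x \<noteq> 0} \<subseteq> \<Omega>}"

definition L2 :: "(real ^ 'n::finite) set \<Rightarrow> (real ^ 'n \<Rightarrow> 'b::real_normed_vector) set" where
  "L2 \<Omega> = {f. f \<in> borel_measurable (lebesgue_on \<Omega>) \<and>
              integrable (lebesgue_on \<Omega>) (\<lambda>x. (norm (f x))\<^sup>2)}"

definition has_weak_gradient ::
    "(real ^ 'n::finite) set \<Rightarrow> (real ^ 'n \<Rightarrow> real) \<Rightarrow> (real ^ 'n \<Rightarrow> real ^ 'n) \<Rightarrow> bool" where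
  "has_weak_gradient \<Omega> u G \<longleftrightarrow> u \<in> L2 \<Omega> \<and> G \<in> L2 \<Omega> \<and>
     (\<forall>\<psi>\<in>test_functions \<Omega>. \<forall>i.
        (LINT x|lebesgue_on \<Omega>. u x * partial_deriv i \<psi> x) = - (LINT x|lebesgue_on \<Omega>. G x $ i * \<psi> x))"

definition H1 :: "(real ^ 'n::finite) set \<Rightarrow> (real ^ 'n \<Rightarrow> real) set" where
  "H1 \<Omega> = {u. \<exists>G. has_weak_gradient \<Omega> u G}"

text \<open>The weak gradient is unique only up to null sets, so \<open>weak_gradient\<close> picks one representative;
  it is used only under integrals, where the choice is irrelevant.\<close>

definition weak_gradient ::
    "(real ^ 'n::finite) set \<Rightarrow> (real ^ 'n \<Rightarrow> real) \<Rightarrow> real ^ 'n \<Rightarrow> real ^ 'n" where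
  "weak_gradient \<Omega> u = (SOME G. has_weak_gradient \<Omega> u G)"

definition H1_norm :: "(real ^ 'n::finite) set \<Rightarrow> (real ^ 'n \<Rightarrow> real) \<Rightarrow> real" where
  "H1_norm \<Omega> u = sqrt (LINT x|lebesgue_on \<Omega>. (u x)\<^sup>2 + (norm (weak_gradient \<Omega> u x))\<^sup>2)"

definition H1_0 :: "(real ^ 'n::finite) set \<Rightarrow> (real ^ 'n \<Rightarrow> real) set" where
  "H1_0 \<Omega> = {w \<in> H1 \<Omega>. \<forall>e>0. \<exists>\<psi>\<in>test_functions \<Omega>. H1_norm \<Omega> (\<lambda>x. w x - \<psi> x) < e}"

definition ess_bounded :: "(real ^ 'n::finite) set \<Rightarrow> (real ^ 'n \<Rightarrow> real) \<Rightarrow> bool" where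
  "ess_bounded \<Omega> f \<longleftrightarrow> f \<in> borel_measurable (lebesgue_on \<Omega>) \<and>
     esssup (lebesgue_on \<Omega>) (\<lambda>x. ereal \<bar>f x\<bar>) < \<infinity>"

text \<open>Meaningful only for essentially bounded functions: \<open>real_of_ereal \<infinity> = 0\<close>.\<close>

definition Linf_norm :: "(real ^ 'n::finite) set \<Rightarrow> (real ^ 'n \<Rightarrow> real) \<Rightarrow> real" where
  "Linf_norm \<Omega> f = real_of_ereal (esssup (lebesgue_on \<Omega>) (\<lambda>x. ereal \<bar>f x\<bar>))"

text \<open>The norm of the potential \<open>\<sigma>\<close> is its supremum over \<^emph>\<open>all\<close> of \<open>\<real>\<close>, not an essential supremum.
  The functional \<open>\<integral> \<sigma>(v)\<close> is not invariant under changes of \<open>\<sigma>\<close> on null sets, since \<open>v\<close> may take a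
  value on a set of positive measure. For instance, in dimension one, if \<open>\<sigma>\<close> is \<open>-K\<close> at \<open>0\<close> and at some
  small \<open>t > 0\<close> and vanishes elsewhere, there are minimizers of slope \<open>sqrt (2 * K)\<close> at the free
  boundary and with maximum \<open>t\<close>; the essential supremum of \<open>\<bar>\<sigma>\<bar>\<close> is \<open>0\<close>.\<close>

definition sup_norm :: "(real \<Rightarrow> real) \<Rightarrow> real" where
  "sup_norm \<sigma> = (SUP t. \<bar>\<sigma> t\<bar>)"

definition energy :: "(real \<Rightarrow> real) \<Rightarrow> (real ^ 'n::finite \<Rightarrow> real) \<Rightarrow> (real ^ 'n) set \<Rightarrow> real" where
  "energy \<sigma> v \<Omega> = (LINT x|lebesgue_on \<Omega>. 1 / 2 * (norm (weak_gradient \<Omega> v x))\<^sup>2 + \<sigma> (v x))"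

definition local_minimizer ::
    "(real \<Rightarrow> real) \<Rightarrow> (real ^ 'n::finite) set \<Rightarrow> (real ^ 'n \<Rightarrow> real) \<Rightarrow> bool" where
  "local_minimizer \<sigma> \<Omega> u \<longleftrightarrow> u \<in> H1 \<Omega> \<and>
     (\<forall>\<Omega>'. open \<Omega>' \<and> \<Omega>' \<subseteq> \<Omega> \<longrightarrow>
        (\<forall>v\<in>H1 \<Omega>'. (\<lambda>x. v x - u x) \<in> H1_0 \<Omega>' \<longrightarrow> energy \<sigma> u \<Omega>' \<le> energy \<sigma> v \<Omega>'))"

end

(*
  Let m > sqrt (sup |sigma|).  Comparing u with u + c Psi for a smooth bump Psi supported in a ball
  of radius r, and optimizing in c, bounds the pairing of u with the Laplacian of Psi by a multiple
  of m r^(n - 1).  For Psi (x) = exp (- 1 / (1 - |x - y|^2 / r^2)) the Laplacian is, up to the factor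
  r^(1 - n) / 2, the derivative in r of the nonnegative kernel
  K_r = r^(- n) F (1 - |x - y|^2 / r^2) with F (t) = exp (- 1 / t) / t^2.  Hence the K_r-averages of u
  around y are Lipschitz in r with constant of order m, and they tend to a multiple of u y as r tends
  to 0: u has an approximate mean value property with error of order m r, and no harmonic replacement
  is needed.  As u x0 = 0, the average around x0 at scale 3 d / 2, with d = |x - x0|, is at most of
  order m d; as u is nonnegative, it dominates the average around x at scale d / 4, and therefore u x.
*)

theory Submission
  imports Defs
begin

text \<open>Since \<open>\<sigma>\<close> is only bounded and measurable, there is no Euler-Lagrange
  equation to start from: minimality gives inequalities for perturbations of finite size only.
  Adding \<open>c\<close> times a bump of radius r costs Dirichlet energy of order c^2 r^(n-2),
  while the potential term changes by at most 2 m^2 times the volume, of order m^2 r^n. The two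
  balance at c of order m r, and this scaling is what produces linear growth. The resulting bound on
  the r-derivative of the averages is uniform in r, so integrating it down to r = 0 costs only order
  m r, without a logarithm. A second obstacle lies in the encoding: the energy uses a gradient
  picked by \<open>SOME\<close>, separately for each open set and each function. It can be expanded
  around u only once weak gradients are known to be unique almost everywhere, which is why the
  fundamental lemma of the calculus of variations is proved here. Finally, m is kept strictly above
  the square root of the supremum because the optimal c is a multiple of m and one divides by it,
  while \<open>\<sigma>\<close> may vanish identically; the theorem lets m decrease to that square
  root.\<close>

section \<open>Smooth functions with compact support\<close>

text \<open>The powers of t in the denominator make the family closed under differentiation up to
  linear combinations. Index 0 gives the barrier, index 2 the kernel, and indices 3 and 4 enter
  through the Laplacian.\<close>

definition bump :: "nat \<Rightarrow> real \<Rightarrow> real" where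
  "bump k t = (if t > 0 then exp (- (1 / t)) / t ^ k else 0)"

lemma bump_nonneg: "bump k t \<ge> 0"
  by (simp add: bump_def)

lemma bump_eq_0_iff: "bump k t = 0 \<longleftrightarrow> t \<le> 0"
  by (auto simp: bump_def)

lemma bump_Suc: "bump k t = t * bump (Suc k) t"
  by (simp add: bump_def)

text \<open>With s = 1 / t, a single term of the exponential series gives s^(k+1) / (k+1)! \<le> exp
  s. This yields both differentiability at 0 and the explicit upper bound for index 2.\<close>

lemma bump_le_linear:
  assumes "t \<ge> 0"
  shows "bump k t \<le> fact (Suc k) * t"
proof (cases "t = 0")
  case False
  then have t: "t > 0" using assms by simp
  define s where "s = 1 / t"
  have s: "s > 0" using t by (simp add: s_def)
  have "s ^ Suc k / fact (Suc k) = (\<Sum>n\<in>{Suc k}. s ^ n /\<^sub>R fact n)"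
    by (simp add: divide_inverse mult_ac)
  also have "\<dots> \<le> (\<Sum>n. s ^ n /\<^sub>R fact n)"
    by (rule sum_le_suminf) (use s summable_exp_generic[of s] in auto)
  finally have "s ^ Suc k / fact (Suc k) \<le> exp s"
    by (simp add: exp_def)
  then have "s ^ Suc k \<le> fact (Suc k) * exp s"
    by (simp add: divide_le_eq mult.commute)
  then have "s ^ k * exp (- s) \<le> fact (Suc k) / s"
    using s by (simp add: exp_minus field_simps del: fact_Suc)
  moreover have "bump k t = s ^ k * exp (- s)"
    using t by (simp add: bump_def s_def power_one_over divide_inverse power_inverse)
  ultimately show ?thesis
    using t by (simp add: s_def del: fact_Suc)
qed (simp add: bump_def)

lemma has_real_derivative_bump:
  "(bump k has_real_derivative bump (k + 2) t - real k * bump (k + 1) t) (at t)"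
proof (cases t "0 :: real" rule: linorder_cases)
  case less
  have "((\<lambda>_. 0) has_real_derivative 0) (at t)" by simp
  then have "(bump k has_real_derivative 0) (at t)"
    by (rule has_field_derivative_transform_within_open[where S = "{..<0}"])
      (use less in \<open>auto simp: bump_def\<close>)
  then show ?thesis using less by (simp add: bump_def)
next
  case equal
  have "((\<lambda>h. bump (k + 1) h) \<longlongrightarrow> 0) (at 0)"
  proof (rule Lim_null_comparison)
    show "\<forall>\<^sub>F h in at 0. norm (bump (k + 1) h) \<le> fact (k + 2) * \<bar>h\<bar>"
    proof (rule always_eventually, rule allI)
      fix h :: real
      show "norm (bump (k + 1) h) \<le> fact (k + 2) * \<bar>h\<bar>"
        using bump_le_linear[of h "k + 1"] bump_nonneg[of "k + 1" h]
        by (cases "h \<ge> 0") (auto simp: bump_def mult_nonneg_nonpos simp del: fact_Suc)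
    qed
    show "((\<lambda>h. fact (k + 2) * \<bar>h\<bar>) \<longlongrightarrow> (0 :: real)) (at 0)"
      by (auto intro!: tendsto_eq_intros)
  qed
  \<comment> \<open>The difference quotient at 0 is again a member of the family, with index raised
    by one, so the linear bound makes it tend to 0.\<close>
  moreover have "(bump k (0 + h) - bump k 0) / h = bump (k + 1) h" if "h \<noteq> 0" for h
    using that bump_Suc[of k h] by (simp add: bump_def)
  ultimately have "((\<lambda>h. (bump k (0 + h) - bump k 0) / h) \<longlongrightarrow> 0) (at 0)"
    by (subst filterlim_cong[OF refl refl, where g = "\<lambda>h. bump (k + 1) h"])
      (auto simp: eventually_at_filter)
  then show ?thesis
    using equal by (simp add: DERIV_def bump_def)
next
  case greater
  have "((\<lambda>t. exp (- (1 / t)) / t ^ k) has_real_derivative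
      (exp (- (1 / t)) * (1 / t\<^sup>2) * t ^ k - exp (- (1 / t)) * (real k * t ^ (k - 1))) / (t ^ k)\<^sup>2) (at t)"
    using greater by (auto intro!: derivative_eq_intros simp: power2_eq_square field_simps)
  also have "(exp (- (1 / t)) * (1 / t\<^sup>2) * t ^ k - exp (- (1 / t)) * (real k * t ^ (k - 1))) / (t ^ k)\<^sup>2
      = bump (k + 2) t - real k * bump (k + 1) t"
    using greater
    by (cases k) (simp_all add: bump_def power2_eq_square field_simps power_add)
  finally show ?thesis
    by (rule has_field_derivative_transform_within_open[where S = "{0<..}"])
      (use greater in \<open>auto simp: bump_def\<close>)
qed

lemma continuous_on_bump [continuous_intros]:
  "continuous_on S f \<Longrightarrow> continuous_on S (\<lambda>x. bump k (f x))"
  by (rule continuous_on_compose2[of UNIV "bump k"])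
    (auto intro!: DERIV_isCont has_real_derivative_bump continuous_at_imp_continuous_on)

section \<open>Rules for partial derivatives\<close>

lemma partial_deriv_eqI:
  "(f has_derivative f') (at x) \<Longrightarrow> partial_deriv i f x = f' (axis i 1)"
  unfolding partial_deriv_def using frechet_derivative_at by metis

lemma partial_deriv_const: "partial_deriv i (\<lambda>x. c) = (\<lambda>x. 0)"
  by (rule ext, rule partial_deriv_eqI[THEN trans]) (auto intro!: derivative_eq_intros)

lemma partial_deriv_component: "partial_deriv i (\<lambda>x. x $ j) = (\<lambda>x. if i = j then 1 else 0)"
  by (rule ext, rule partial_deriv_eqI[where f' = "\<lambda>h. h $ j", THEN trans])
    (auto intro!: derivative_eq_intros bounded_linear_imp_has_derivative simp: axis_def)

lemma partial_deriv_add: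
  assumes "f differentiable (at x)" "g differentiable (at x)"
  shows "partial_deriv i (\<lambda>x. f x + g x) x = partial_deriv i f x + partial_deriv i g x"
proof -
  have "((\<lambda>x. f x + g x) has_derivative
      (\<lambda>h. frechet_derivative f (at x) h + frechet_derivative g (at x) h)) (at x)"
    using assms by (auto intro!: derivative_intros simp: frechet_derivative_works[symmetric])
  from partial_deriv_eqI[OF this] show ?thesis by (simp add: partial_deriv_def)
qed

lemma partial_deriv_mult:
  assumes "f differentiable (at x)" "g differentiable (at x)"
  shows "partial_deriv i (\<lambda>x. f x * g x) x = f x * partial_deriv i g x + partial_deriv i f x * g x"
proof -
  have "((\<lambda>x. f x * g x) has_derivative
      (\<lambda>h. f x * frechet_derivative g (at x) h + frechet_derivative f (at x) h * g x)) (at x)"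
    using assms by (auto intro!: derivative_intros simp: frechet_derivative_works[symmetric])
  from partial_deriv_eqI[OF this] show ?thesis by (simp add: partial_deriv_def)
qed

lemma has_derivative_bump:
  assumes "f differentiable (at x)"
  shows "((\<lambda>x. bump k (f x)) has_derivative
    (\<lambda>h. frechet_derivative f (at x) h * (bump (k + 2) (f x) - real k * bump (k + 1) (f x)))) (at x)"
proof (rule has_derivative_eq_rhs)
  show "((\<lambda>x. bump k (f x)) has_derivative (\<lambda>h. (bump (k + 2) (f x) - real k * bump (k + 1) (f x)) *
      frechet_derivative f (at x) h)) (at x)"
    using assms unfolding frechet_derivative_works
    by (rule has_derivative_compose)
      (use has_real_derivative_bump[of k "f x"] in \<open>simp add: has_field_derivative_def\<close>)
qed (auto simp: mult.commute)

lemma partial_deriv_bump: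
  assumes "f differentiable (at x)"
  shows "partial_deriv i (\<lambda>x. bump k (f x)) x =
    partial_deriv i f x * (bump (k + 2) (f x) - real k * bump (k + 1) (f x))"
  using partial_deriv_eqI[OF has_derivative_bump[OF assms]] by (simp add: partial_deriv_def)

text \<open>\<open>Ck\<close> recurses through all partial derivatives, so proving it by induction
  on the order needs a class that \<open>partial_deriv\<close> maps into itself. These generators
  suffice for every test function built below; allowing every \<open>k\<close> in
  \<open>smooth_bump\<close> is essential, as differentiation raises the index.\<close>

inductive_set smooth :: "(real ^ 'n::finite \<Rightarrow> real) set" where
  smooth_const: "(\<lambda>x. c) \<in> smooth"
| smooth_component: "(\<lambda>x. x $ i) \<in> smooth"
| smooth_add: "f \<in> smooth \<Longrightarrow> g \<in> smooth \<Longrightarrow> (\<lambda>x. f x + g x) \<in> smooth"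
| smooth_mult: "f \<in> smooth \<Longrightarrow> g \<in> smooth \<Longrightarrow> (\<lambda>x. f x * g x) \<in> smooth"
| smooth_bump: "f \<in> smooth \<Longrightarrow> (\<lambda>x. bump k (f x)) \<in> smooth"

lemma smooth_differentiable: "f \<in> smooth \<Longrightarrow> f differentiable (at x)"
proof (induction rule: smooth.induct)
  case (smooth_component i)
  show ?case
    by (intro linear_imp_differentiable bounded_linear.linear bounded_linear_vec_nth)
next
  case (smooth_bump f k)
  then show ?case using has_derivative_bump[of f x k] by (auto simp: differentiable_def)
qed simp_all

lemma smooth_diff: "f \<in> smooth \<Longrightarrow> g \<in> smooth \<Longrightarrow> (\<lambda>x. f x - g x) \<in> smooth"
  using smooth_add[of f "\<lambda>x. -1 * g x"] smooth_mult[OF smooth_const[of "-1"], of g] by simp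

lemma smooth_sum: "(\<And>i. i \<in> I \<Longrightarrow> f i \<in> smooth) \<Longrightarrow> (\<lambda>x. \<Sum>i\<in>I. f i x) \<in> smooth"
  by (induction I rule: infinite_finite_induct) (simp_all add: smooth_const smooth_add smooth_mult)

lemma smooth_prod: "(\<And>i. i \<in> I \<Longrightarrow> f i \<in> smooth) \<Longrightarrow> (\<lambda>x. \<Prod>i\<in>I. f i x) \<in> smooth"
  by (induction I rule: infinite_finite_induct) (simp_all add: smooth_const smooth_add smooth_mult)

lemma smooth_partial_deriv: "f \<in> smooth \<Longrightarrow> partial_deriv i f \<in> smooth"
proof (induction rule: smooth.induct)
  case (smooth_component j)
  show ?case by (simp add: partial_deriv_component smooth_const)
next
  case (smooth_add f g)
  have "partial_deriv i (\<lambda>x. f x + g x) = (\<lambda>x. partial_deriv i f x + partial_deriv i g x)"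
    using smooth_add by (auto intro!: partial_deriv_add smooth_differentiable)
  then show ?case using smooth_add by (auto intro: smooth.intros)
next
  case (smooth_mult f g)
  have "partial_deriv i (\<lambda>x. f x * g x) =
      (\<lambda>x. f x * partial_deriv i g x + partial_deriv i f x * g x)"
    using smooth_mult by (auto intro!: partial_deriv_mult smooth_differentiable)
  then show ?case using smooth_mult by (auto intro: smooth.intros)
next
  case (smooth_bump f k)
  have "partial_deriv i (\<lambda>x. bump k (f x)) =
      (\<lambda>x. partial_deriv i f x * (bump (k + 2) (f x) - real k * bump (k + 1) (f x)))"
    using partial_deriv_bump[OF smooth_differentiable[OF smooth_bump(1)]] by (rule ext)
  then show ?case using smooth_bump by (auto intro!: smooth.intros smooth_diff)
qed (simp add: partial_deriv_const smooth_const)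

lemma smooth_imp_Ck: "f \<in> smooth \<Longrightarrow> Ck k f"
proof (induction k arbitrary: f)
  case 0
  then show ?case
    by (auto intro!: continuous_at_imp_continuous_on differentiable_imp_continuous_within
        smooth_differentiable)
qed (simp add: smooth_differentiable smooth_partial_deriv)

section \<open>Test functions and their supports\<close>

lemma test_functionsI:
  assumes "f \<in> smooth" "\<And>x. x \<notin> K \<Longrightarrow> f x = 0" "compact K" "K \<subseteq> \<Omega>"
  shows "f \<in> test_functions \<Omega>"
proof -
  have "closure {x. f x \<noteq> 0} \<subseteq> K"
    by (rule closure_minimal) (use assms in \<open>auto intro: compact_imp_closed\<close>)
  moreover from this have "compact (closure {x. f x \<noteq> 0})"
    using assms(3) compact_Int_closed[of K "closure {x. f x \<noteq> 0}"]
    by (simp add: Int_absorb1)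
  ultimately show ?thesis
    using assms(4) smooth_imp_Ck[OF assms(1)] by (simp add: test_functions_def)
qed

lemma test_functions_differentiable: "\<psi> \<in> test_functions \<Omega> \<Longrightarrow> \<psi> differentiable (at x)"
  using Ck.simps(2)[of 0 \<psi>] by (simp add: test_functions_def del: Ck.simps)

lemma test_functions_continuous: "\<psi> \<in> test_functions \<Omega> \<Longrightarrow> continuous_on S \<psi>"
  using Ck.simps(1)[of \<psi>] continuous_on_subset[of UNIV \<psi> S]
  by (simp add: test_functions_def del: Ck.simps)

lemma test_functions_support:
  assumes "\<psi> \<in> test_functions \<Omega>"
  obtains K where "compact K" "K \<subseteq> \<Omega>" "\<And>x. x \<notin> K \<Longrightarrow> \<psi> x = 0"
proof
  show "compact (closure {x. \<psi> x \<noteq> 0})" "closure {x. \<psi> x \<noteq> 0} \<subseteq> \<Omega>"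
    using assms by (auto simp: test_functions_def)
  show "\<psi> x = 0" if "x \<notin> closure {x. \<psi> x \<noteq> 0}" for x
    using that closure_subset[of "{x. \<psi> x \<noteq> 0}"] by auto
qed

lemma partial_deriv_eq_0:
  assumes "x \<notin> closure {x. f x \<noteq> 0}"
  shows "partial_deriv i f x = 0"
proof -
  have "(f has_derivative (\<lambda>h. 0)) (at x)"
  proof (rule has_derivative_transform_within_open)
    show "((\<lambda>x. 0) has_derivative (\<lambda>h. 0)) (at x)" by simp
    show "open (- closure {x. f x \<noteq> 0})" by (simp add: open_Compl)
    show "0 = f y" if "y \<in> - closure {x. f x \<noteq> 0}" for y
      using that closure_subset[of "{x. f x \<noteq> 0}"] by auto
  qed (use assms in auto)
  then show ?thesis by (rule partial_deriv_eqI)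
qed

lemma test_functions_partial_deriv:
  assumes "\<psi> \<in> test_functions \<Omega>"
  shows "partial_deriv i \<psi> \<in> test_functions \<Omega>"
proof -
  let ?K = "closure {x. \<psi> x \<noteq> 0}" and ?L = "closure {x. partial_deriv i \<psi> x \<noteq> 0}"
  have K: "compact ?K" "?K \<subseteq> \<Omega>" and C: "Ck k \<psi>" for k
    using assms by (auto simp: test_functions_def)
  have "?L \<subseteq> ?K"
    by (rule closure_minimal) (use partial_deriv_eq_0[of _ \<psi> i] in auto)
  moreover from this have "compact ?L"
    using compact_Int_closed[OF K(1), of ?L] by (simp add: Int_absorb1)
  moreover have "Ck k (partial_deriv i \<psi>)" for k
    using C[of "Suc k"] by simp
  ultimately show ?thesis using K by (auto simp: test_functions_def)
qed

lemma test_functions_mono: "\<psi> \<in> test_functions \<Omega> \<Longrightarrow> \<Omega> \<subseteq> \<Omega>' \<Longrightarrow> \<psi> \<in> test_functions \<Omega>'"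
  by (auto simp: test_functions_def)

lemma test_functions_eq_0: "\<psi> \<in> test_functions \<Omega> \<Longrightarrow> x \<notin> \<Omega> \<Longrightarrow> \<psi> x = 0"
  using closure_subset[of "{x. \<psi> x \<noteq> 0}"] by (auto simp: test_functions_def)

section \<open>Integration by parts\<close>

text \<open>Bridge from the Lebesgue integral over \<open>\<Omega>\<close> to the gauge integral
  over a box, where the Leibniz rule for differentiation under the integral is available.\<close>

lemma lebesgue_on_compact_support:
  fixes f :: "'a::euclidean_space \<Rightarrow> real"
  assumes f: "continuous_on UNIV f" "\<And>x. x \<notin> K \<Longrightarrow> f x = 0"
    and K: "K \<subseteq> \<Omega>" "K \<subseteq> cbox a b" and \<Omega>: "\<Omega> \<in> sets lebesgue"
  shows "integrable (lebesgue_on \<Omega>) f"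
    and "(LINT x|lebesgue_on \<Omega>. f x) = integral (cbox a b) f"
proof -
  have abs: "f absolutely_integrable_on cbox a b"
    by (intro absolutely_integrable_continuous continuous_on_subset[OF f(1)]) auto
  have 1: "(\<lambda>x. indicator (cbox a b) x *\<^sub>R f x) = f" "(\<lambda>x. indicator \<Omega> x *\<^sub>R f x) = f"
    using f(2) K by (fastforce simp: indicator_def)+
  show "integrable (lebesgue_on \<Omega>) f"
    using abs \<Omega> by (simp add: integrable_restrict_space set_integrable_def 1 del: real_scaleR_def)
  have "(LINT x|lebesgue_on \<Omega>. f x) = (LINT x|lebesgue. f x)"
    using \<Omega> by (simp add: integral_restrict_space 1 del: real_scaleR_def)
  also have "\<dots> = integral (cbox a b) f"
    using set_lebesgue_integral_eq_integral(2)[OF abs] by (simp add: set_lebesgue_integral_def 1 del: real_scaleR_def)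
  finally show "(LINT x|lebesgue_on \<Omega>. f x) = integral (cbox a b) f" .
qed

lemma lebesgue_integral_translation:
  fixes f :: "'a::euclidean_space \<Rightarrow> real"
  assumes "continuous_on UNIV f"
  shows "(LINT x|lebesgue. f (c + x)) = (LINT x|lebesgue. f x)"
proof -
  have f [measurable]: "f \<in> borel_measurable borel"
    using assms by (simp add: borel_measurable_continuous_onI)
  have "(LINT x|lebesgue. f x) = (LINT x|lborel. f x)"
    by (simp add: integral_completion)
  also have "\<dots> = (LINT x|distr lborel borel ((+) c). f x)"
    by (simp add: lborel_distr_plus)
  also have "\<dots> = (LINT x|lborel. f (c + x))"
    by (rule integral_distr) auto
  also have "\<dots> = (LINT x|lebesgue. f (c + x))"
    by (simp add: integral_completion)
  finally show ?thesis by simp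
qed

text \<open>The integral of the translates of \<open>f\<close> along the i-th axis does not depend
  on the shift; differentiating it under the integral at shift 0 gives the claim.\<close>

lemma integral_partial_deriv_eq_0:
  fixes f :: "real ^ 'n::finite \<Rightarrow> real"
  assumes f: "\<And>x. f differentiable (at x)" "continuous_on UNIV (partial_deriv i f)"
    and K: "compact K" "\<And>x. x \<notin> K \<Longrightarrow> f x = 0" "K \<subseteq> \<Omega>" and \<Omega>: "\<Omega> \<in> sets lebesgue"
  shows "(LINT x|lebesgue_on \<Omega>. partial_deriv i f x) = 0"
proof -
  let ?e = "axis i 1 :: real ^ 'n"
  have contf: "continuous_on UNIV f"
    using f(1) by (auto intro!: continuous_at_imp_continuous_on differentiable_imp_continuous_within)
  obtain B where B: "\<And>x. x \<in> K \<Longrightarrow> norm x \<le> B"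
    using compact_imp_bounded[OF K(1)] by (auto simp: bounded_iff)
  \<comment> \<open>Shifts of length at most 1 keep the support inside the ball of radius
    \<open>B + 1\<close>, so one fixed box serves all of them.\<close>
  obtain c where c: "cball (0 :: real ^ 'n) (B + 1) \<subseteq> cbox (- c) c"
    using bounded_subset_cbox_symmetric[OF bounded_cball] by blast
  have supp: "f (t *\<^sub>R ?e + x) = 0" if "t \<in> {-1..1}" "x \<notin> cball 0 (B + 1)" for t x
  proof (rule K(2), rule notI)
    assume "t *\<^sub>R ?e + x \<in> K"
    then have "norm (t *\<^sub>R ?e + x) \<le> B" by (rule B)
    moreover have "norm x \<le> norm (t *\<^sub>R ?e + x) + norm (t *\<^sub>R ?e)"
        using norm_triangle_ineq4[of "t *\<^sub>R ?e + x" "t *\<^sub>R ?e"] by simp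
    moreover have "norm (t *\<^sub>R ?e) \<le> 1" using that(1) by (simp add: abs_le_iff)
    ultimately show False using that by simp
  qed
  have supp': "partial_deriv i f x = 0" if "x \<notin> K" for x
  proof (rule partial_deriv_eq_0)
    have "closure {x. f x \<noteq> 0} \<subseteq> K"
      by (rule closure_minimal) (use K in \<open>auto intro: compact_imp_closed\<close>)
    then show "x \<notin> closure {x. f x \<noteq> 0}" using that by auto
  qed
  define \<phi> where "\<phi> t = integral (cbox (- c) c) (\<lambda>x. f (t *\<^sub>R ?e + x))" for t
  have const: "\<phi> t = (LINT x|lebesgue. f x)" if "t \<in> {-1..1}" for t
  proof -
    have "(LINT x|lebesgue_on UNIV. f (t *\<^sub>R ?e + x)) = \<phi> t"
      unfolding \<phi>_def using supp[OF that] c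
      by (intro lebesgue_on_compact_support(2)[where K = "cball 0 (B + 1)"])
        (auto intro!: continuous_on_compose2[OF contf] continuous_intros)
    then show ?thesis
      using lebesgue_integral_translation[OF contf, of "t *\<^sub>R ?e"]
      by (simp add: lebesgue_on_UNIV_eq)
  qed
  have "(\<phi> has_real_derivative integral (cbox (- c) c) (\<lambda>x. partial_deriv i f (0 *\<^sub>R ?e + x)))
      (at 0 within {-1..1})"
    unfolding \<phi>_def
  proof (rule leibniz_rule_field_derivative)
    fix t x
    have 1: "((\<lambda>t. t *\<^sub>R ?e + x) has_derivative (\<lambda>h. h *\<^sub>R ?e)) (at t)"
      by (auto intro!: derivative_eq_intros)
    have "(f has_derivative frechet_derivative f (at (t *\<^sub>R ?e + x))) (at (t *\<^sub>R ?e + x))"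
      using f(1) by (simp add: frechet_derivative_works[symmetric])
    from has_derivative_compose[OF 1 this]
    have "((\<lambda>t. f (t *\<^sub>R ?e + x)) has_derivative
        (\<lambda>h. frechet_derivative f (at (t *\<^sub>R ?e + x)) (h *\<^sub>R ?e))) (at t)" .
    also have "(\<lambda>h. frechet_derivative f (at (t *\<^sub>R ?e + x)) (h *\<^sub>R ?e)) =
        (*) (partial_deriv i f (t *\<^sub>R ?e + x))"
      using linear_cmul[OF linear_frechet_derivative[OF f(1)]]
      by (auto simp: partial_deriv_def mult.commute)
    finally show "((\<lambda>t. f (t *\<^sub>R ?e + x)) has_field_derivative partial_deriv i f (t *\<^sub>R ?e + x))
        (at t within {-1..1})"
      by (auto simp: has_field_derivative_def intro: has_derivative_at_withinI)
  next
    show "(\<lambda>x. f (t *\<^sub>R ?e + x)) integrable_on cbox (- c) c" for t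
      by (intro integrable_continuous continuous_on_compose2[OF contf] continuous_intros) auto
  next
    show "continuous_on ({-1..1} \<times> cbox (- c) c) (\<lambda>(t, x). partial_deriv i f (t *\<^sub>R ?e + x))"
      unfolding case_prod_unfold
      by (intro continuous_on_compose2[OF f(2)] continuous_intros) auto
  qed auto
  then have "(\<phi> has_real_derivative integral (cbox (- c) c) (partial_deriv i f)) (at 0)"
    by (simp add: at_within_Icc_at)
  moreover have "(\<phi> has_real_derivative 0) (at 0)"
    by (rule has_field_derivative_transform_within_open[where S = "{-1<..<1}"
          and f = "\<lambda>_. LINT x|lebesgue. f x"]) (auto simp: const)
  ultimately have "integral (cbox (- c) c) (partial_deriv i f) = 0"
    by (rule DERIV_unique)
  moreover have "K \<subseteq> cbox (- c) c" using B c by force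
  ultimately show ?thesis
    using lebesgue_on_compact_support(2)[OF f(2) supp' K(3) _ \<Omega>] by simp
qed

lemma test_functions_L2:
  assumes "\<psi> \<in> test_functions \<Omega>" "open \<Omega>"
  shows "\<psi> \<in> L2 \<Omega>"
proof -
  obtain K where K: "compact K" "K \<subseteq> \<Omega>" "\<And>x. x \<notin> K \<Longrightarrow> \<psi> x = 0"
    using test_functions_support[OF assms(1)] by metis
  obtain c where c: "K \<subseteq> cbox (- c) c"
    using bounded_subset_cbox_symmetric[OF compact_imp_bounded[OF K(1)]] by blast
  have cont: "continuous_on S \<psi>" for S using assms(1) by (rule test_functions_continuous)
  have "\<Omega> \<in> sets lebesgue" using assms by auto
  then have "integrable (lebesgue_on \<Omega>) (\<lambda>x. (\<psi> x)\<^sup>2)"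
    by (intro lebesgue_on_compact_support(1)[OF _ _ K(2) c] continuous_intros cont) (simp_all add: K(3))
  moreover have "\<psi> \<in> borel_measurable (lebesgue_on \<Omega>)"
    using \<open>\<Omega> \<in> sets lebesgue\<close> by (intro continuous_imp_measurable_on_sets_lebesgue cont)
  ultimately show ?thesis by (simp add: L2_def)
qed

lemma L2_vec_nth:
  fixes G :: "real ^ 'n::finite \<Rightarrow> real ^ 'n"
  assumes "G \<in> L2 \<Omega>"
  shows "(\<lambda>x. G x $ i) \<in> L2 \<Omega>"
proof -
  have [measurable]: "G \<in> borel_measurable (lebesgue_on \<Omega>)" using assms by (simp add: L2_def)
  have meas: "(\<lambda>x. G x $ i) \<in> borel_measurable (lebesgue_on \<Omega>)"
    by (rule measurable_compose[where N = borel and g = "\<lambda>v. v $ i"])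
      (auto intro!: borel_measurable_continuous_onI continuous_intros)
  note meas [measurable]
  have "integrable (lebesgue_on \<Omega>) (\<lambda>x. (norm (G x $ i))\<^sup>2)"
  proof (rule Bochner_Integration.integrable_bound)
    show "integrable (lebesgue_on \<Omega>) (\<lambda>x. (norm (G x))\<^sup>2)" using assms by (simp add: L2_def)
    show "AE x in lebesgue_on \<Omega>. norm ((norm (G x $ i))\<^sup>2) \<le> norm ((norm (G x))\<^sup>2)"
    proof (rule AE_I2)
      fix x
      show "norm ((norm (G x $ i))\<^sup>2) \<le> norm ((norm (G x))\<^sup>2)"
        using power_mono[OF component_le_norm_cart[of "G x" i] abs_ge_zero, of 2] by simp
    qed
  qed measurable
  then show ?thesis using meas by (simp add: L2_def)
qed

lemma L2_mult_integrable:
  fixes f g :: "real ^ 'n::finite \<Rightarrow> real"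
  assumes "f \<in> L2 \<Omega>" "g \<in> L2 \<Omega>"
  shows "integrable (lebesgue_on \<Omega>) (\<lambda>x. f x * g x)"
proof (rule Bochner_Integration.integrable_bound)
  show "integrable (lebesgue_on \<Omega>) (\<lambda>x. (f x)\<^sup>2 + (g x)\<^sup>2)" using assms by (simp add: L2_def)
  show "(\<lambda>x. f x * g x) \<in> borel_measurable (lebesgue_on \<Omega>)" using assms by (auto simp: L2_def)
  have "\<bar>a * b\<bar> \<le> a\<^sup>2 + b\<^sup>2" for a b :: real
    using sum_squares_bound[of "\<bar>a\<bar>" "\<bar>b\<bar>"] mult_nonneg_nonneg[of "\<bar>a\<bar>" "\<bar>b\<bar>"]
    by (simp add: abs_mult del: mult_nonneg_nonneg)
  then show "AE x in lebesgue_on \<Omega>. norm (f x * g x) \<le> norm ((f x)\<^sup>2 + (g x)\<^sup>2)"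
    by (intro AE_I2) (simp add: order_trans[OF _ abs_ge_self])
qed

lemma integration_by_parts_test_functions:
  assumes \<psi>: "\<psi> \<in> test_functions \<Omega>" and \<eta>: "\<eta> \<in> test_functions \<Omega>" and "open \<Omega>"
  shows "(LINT x|lebesgue_on \<Omega>. \<psi> x * partial_deriv i \<eta> x) =
    - (LINT x|lebesgue_on \<Omega>. partial_deriv i \<psi> x * \<eta> x)"
proof -
  obtain K where K: "compact K" "K \<subseteq> \<Omega>" "\<And>x. x \<notin> K \<Longrightarrow> \<psi> x = 0"
    using test_functions_support[OF \<psi>] by metis
  note diff = test_functions_differentiable[OF \<psi>] test_functions_differentiable[OF \<eta>]
  note test = \<psi> \<eta> test_functions_partial_deriv[OF \<psi>] test_functions_partial_deriv[OF \<eta>]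
  have eq: "partial_deriv i (\<lambda>x. \<psi> x * \<eta> x) = (\<lambda>x. \<psi> x * partial_deriv i \<eta> x + partial_deriv i \<psi> x * \<eta> x)"
    using diff by (auto intro!: partial_deriv_mult)
  have "(LINT x|lebesgue_on \<Omega>. partial_deriv i (\<lambda>x. \<psi> x * \<eta> x) x) = 0"
  proof (rule integral_partial_deriv_eq_0)
    show "(\<lambda>x. \<psi> x * \<eta> x) differentiable (at x)" for x
      using diff by (rule differentiable_mult)
    show "continuous_on UNIV (partial_deriv i (\<lambda>x. \<psi> x * \<eta> x))"
      unfolding eq by (intro continuous_intros test[THEN test_functions_continuous])
    show "\<psi> x * \<eta> x = 0" if "x \<notin> K" for x
      using K that by auto
  qed (use assms(3) K in auto)
  then show ?thesis unfolding eq
    by (subst (asm) Bochner_Integration.integral_add)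
      (auto intro!: L2_mult_integrable test_functions_L2 test assms(3))
qed

section \<open>Uniqueness of weak gradients\<close>

text \<open>The indicator of an open box is a pointwise limit of test functions:
  \<open>bump 0\<close> increases to 1 at infinity, so products of steepened copies, one for each
  face, tend to 1 inside the box and vanish outside.\<close>

lemma integral_box_eq_0:
  fixes d :: "real ^ 'n::finite \<Rightarrow> real"
  assumes d: "d \<in> L2 \<Omega>" and "open \<Omega>" and ab: "cbox a b \<subseteq> \<Omega>"
    and zero: "\<And>\<psi>. \<psi> \<in> test_functions \<Omega> \<Longrightarrow> (LINT x|lebesgue_on \<Omega>. d x * \<psi> x) = 0"
  shows "(LINT x|lebesgue_on \<Omega>. d x * indicator (box a b) x) = 0"
proof -
  have [measurable]: "\<Omega> \<in> sets lebesgue" using \<open>open \<Omega>\<close> by auto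
  have d_meas: "d \<in> borel_measurable (lebesgue_on \<Omega>)"
    and d_int: "integrable (lebesgue_on \<Omega>) (\<lambda>x. (d x)\<^sup>2)"
    using d by (auto simp: L2_def)
  define \<psi> :: "nat \<Rightarrow> real ^ 'n \<Rightarrow> real" where
    "\<psi> m x = (\<Prod>i\<in>UNIV. bump 0 (real (Suc m) * (x $ i - a $ i)) * bump 0 (real (Suc m) * (b $ i - x $ i)))"
    for m x
  have \<psi>_0: "\<psi> m x = 0" if "x \<notin> box a b" for m x
  proof -
    from that obtain i where "x $ i \<le> a $ i \<or> b $ i \<le> x $ i"
      by (auto simp: mem_box_cart not_less)
    then have "bump 0 (real (Suc m) * (x $ i - a $ i)) * bump 0 (real (Suc m) * (b $ i - x $ i)) = 0"
      by (auto simp: bump_eq_0_iff mult_le_0_iff simp del: of_nat_Suc)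
    then show ?thesis unfolding \<psi>_def by (intro prod_zero) auto
  qed
  have bump_le: "bump 0 t \<le> 1" for t by (simp add: bump_def)
  have \<psi>_le: "0 \<le> \<psi> m x" "\<psi> m x \<le> 1" for m x
    unfolding \<psi>_def
    by (intro prod_nonneg prod_le_1 ballI conjI mult_nonneg_nonneg mult_le_one bump_le bump_nonneg)+
  have \<psi>_smooth: "\<psi> m \<in> smooth" for m
    unfolding \<psi>_def
    by (intro smooth_prod smooth_mult smooth_bump smooth_diff smooth_const smooth_component)
  have \<psi>_test: "\<psi> m \<in> test_functions \<Omega>" for m
    by (rule test_functionsI[OF \<psi>_smooth _ compact_cbox ab])
      (use \<psi>_0 box_subset_cbox[of a b] in auto)
  have \<psi>_lim: "(\<lambda>m. \<psi> m x) \<longlonglongrightarrow> indicator (box a b) x" for x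
  proof (cases "x \<in> box a b")
    case True
    have lim: "(\<lambda>m. bump 0 (real (Suc m) * c)) \<longlonglongrightarrow> 1" if "c > 0" for c
    proof -
      have "(\<lambda>m. exp (- (inverse (real (Suc m)) * inverse c))) \<longlonglongrightarrow> exp (- (0 * inverse c))"
        by (intro tendsto_intros LIMSEQ_inverse_real_of_nat)
      moreover have "exp (- (inverse (real (Suc m)) * inverse c)) = bump 0 (real (Suc m) * c)" for m
        using that by (simp add: bump_def divide_inverse mult_pos_pos del: of_nat_Suc)
      ultimately show ?thesis by simp
    qed
    have "(\<lambda>m. \<psi> m x) \<longlonglongrightarrow> (\<Prod>i\<in>(UNIV :: 'n set). 1 * 1)"
      unfolding \<psi>_def by (intro tendsto_prod tendsto_mult lim) (use True in \<open>auto simp: mem_box_cart\<close>)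
    then show ?thesis using True by simp
  qed (simp add: \<psi>_0)
  have fin: "integrable (lebesgue_on \<Omega>) (indicator (cbox a b) :: _ \<Rightarrow> real)"
    using ab emeasure_lborel_cbox_finite[of a b] by (intro integrable_real_indicator)
      (auto simp: sets_restrict_space_iff emeasure_restrict_space)
  have "(\<lambda>m. LINT x|lebesgue_on \<Omega>. d x * \<psi> m x) \<longlonglongrightarrow>
      (LINT x|lebesgue_on \<Omega>. d x * indicator (box a b) x)"
  \<comment> \<open>The dominating function comes from 2 |d| \<le> d^2 + 1 on the closed box, since
    \<open>d\<close> is only known to be square integrable.\<close>
  proof (rule integral_dominated_convergence[where w = "\<lambda>x. (d x)\<^sup>2 + indicator (cbox a b) x"])
    show "(\<lambda>x. d x * indicat_real (box a b) x) \<in> borel_measurable (lebesgue_on \<Omega>)"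
      using d_meas by (intro borel_measurable_times borel_measurable_indicator)
        (use ab box_subset_cbox[of a b] in \<open>auto simp: sets_restrict_space_iff\<close>)
    show "(\<lambda>x. d x * \<psi> m x) \<in> borel_measurable (lebesgue_on \<Omega>)" for m
      using d_meas test_functions_L2[OF \<psi>_test[of m] \<open>open \<Omega>\<close>]
      by (intro borel_measurable_times) (auto simp: L2_def)
    show "integrable (lebesgue_on \<Omega>) (\<lambda>x. (d x)\<^sup>2 + indicator (cbox a b) x)"
      using d_int fin by (rule Bochner_Integration.integrable_add)
    show "AE x in lebesgue_on \<Omega>. (\<lambda>m. d x * \<psi> m x) \<longlonglongrightarrow> d x * indicator (box a b) x"
      by (intro AE_I2 tendsto_intros \<psi>_lim)
    show "AE x in lebesgue_on \<Omega>. norm (d x * \<psi> m x) \<le> (d x)\<^sup>2 + indicator (cbox a b) x" for m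
    proof (rule AE_I2)
      fix x
      have "\<bar>d x\<bar> * \<psi> m x \<le> \<bar>d x\<bar> * 1"
        by (intro mult_left_mono \<psi>_le) auto
      moreover have "2 * \<bar>d x\<bar> \<le> (d x)\<^sup>2 + 1"
        using sum_squares_bound[of "\<bar>d x\<bar>" 1] by simp
      ultimately show "norm (d x * \<psi> m x) \<le> (d x)\<^sup>2 + indicator (cbox a b) x"
        using \<psi>_0[of x m] box_subset_cbox[of a b] \<psi>_le[of m x]
        by (cases "x \<in> cbox a b"; cases "x \<in> box a b") (auto simp: abs_mult)
    qed
  qed
  then show ?thesis
    using zero[OF \<psi>_test] by (simp add: LIMSEQ_const_iff)
qed

text \<open>Boxes are stable under intersection and generate the Borel sets, so they determine the
  signed measure with density \<open>d\<close>.\<close>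

lemma AE_box_eq_0:
  fixes d :: "real ^ 'n::finite \<Rightarrow> real"
  assumes d: "d \<in> L2 \<Omega>" and "open \<Omega>" and ab: "cbox a b \<subseteq> \<Omega>"
    and zero: "\<And>\<psi>. \<psi> \<in> test_functions \<Omega> \<Longrightarrow> (LINT x|lebesgue_on \<Omega>. d x * \<psi> x) = 0"
  shows "AE x in lebesgue. x \<in> box a b \<longrightarrow> d x = 0"
proof -
  have [measurable]: "\<Omega> \<in> sets lebesgue" using \<open>open \<Omega>\<close> by auto
  define g where "g x = indicator (box a b) x * d x" for x
  have g_eq: "indicator \<Omega> x *\<^sub>R (indicator (box a b) x * d x) = g x" for x
    using ab box_subset_cbox[of a b] by (auto simp: g_def indicator_def)
  have ind: "(indicator (box a b) :: _ \<Rightarrow> real) \<in> L2 \<Omega>"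
  proof -
    have sq: "(\<lambda>x. (norm (indicator (box a b) x :: real))\<^sup>2) = indicator (box a b)"
      by (auto simp: indicator_def)
    have "box a b \<subseteq> \<Omega>" using ab box_subset_cbox[of a b] by auto
    then have "box a b \<in> sets (lebesgue_on \<Omega>)" "emeasure (lebesgue_on \<Omega>) (box a b) < \<infinity>"
      using emeasure_lborel_box_finite[of a b]
      by (auto simp: sets_restrict_space_iff emeasure_restrict_space)
    then show ?thesis
      unfolding L2_def mem_Collect_eq sq
      by (intro conjI borel_measurable_indicator integrable_real_indicator)
  qed
  have g_int: "integrable lebesgue g"
    using L2_mult_integrable[OF ind d]
    by (simp add: integrable_restrict_space g_eq del: real_scaleR_def)
  have g_box: "(LINT x|lebesgue. indicator (box c e) x * g x) = 0" for c e
  proof (cases "box a b \<inter> box c e = {}")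
    case True
    then have eq: "(\<lambda>x. indicator (box c e) x * g x) = (\<lambda>x. 0)"
      by (auto simp: g_def fun_eq_iff split: split_indicator)
    show ?thesis unfolding eq by simp
  next
    case False
    obtain p q where pq: "box a b \<inter> box c e = box p q"
      using box_Int_box[of a b c e] by blast
    \<comment> \<open>The previous lemma needs the closed box inside \<open>\<Omega>\<close>. A
      nonempty open box has the closed box as its closure, which stays in \<open>cbox a b\<close>;
      an empty intersection was split off because this identity fails there.\<close>
    have "cbox p q = closure (box p q)" using False pq by (simp add: closure_box)
    also have "\<dots> \<subseteq> closure (box a b)" using pq by (intro closure_mono) auto
    also have "\<dots> \<subseteq> cbox a b" by (intro closure_minimal box_subset_cbox closed_cbox)
    finally have "cbox p q \<subseteq> \<Omega>" using ab by simp
    then have "(LINT x|lebesgue_on \<Omega>. d x * indicator (box p q) x) = 0"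
      by (intro integral_box_eq_0 assms)
    moreover have "indicator \<Omega> x *\<^sub>R (d x * indicator (box p q) x) = indicator (box c e) x * g x" for x
      using ab box_subset_cbox[of a b] by (auto simp: g_def indicator_def simp flip: pq)
    ultimately show ?thesis
      by (simp add: integral_restrict_space del: real_scaleR_def)
  qed
  \<comment> \<open>Generation by boxes concerns Borel sets, so \<open>g\<close> is replaced by a
    Borel function equal to it almost everywhere.\<close>
  obtain h where h [measurable]: "h \<in> borel_measurable lborel" and gh: "AE x in lborel. g x = h x"
    using completion_ex_borel_measurable_real[of g lborel] g_int by auto
  have gh': "AE x in lebesgue. g x = h x" using gh by (rule AE_completion)
  have meas: "g \<in> borel_measurable lebesgue" "h \<in> borel_measurable lebesgue"
    using borel_measurable_integrable[OF g_int] measurable_completion[OF h] by auto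
  have transfer: "(LINT x|lebesgue. indicator A x * g x) = (LINT x:A|lborel. h x)"
    if [measurable]: "A \<in> sets borel" for A
  proof -
    have "(LINT x|lebesgue. indicator A x * g x) = (LINT x|lebesgue. indicator A x * h x)"
      using gh' by (intro integral_cong_AE borel_measurable_times meas borel_measurable_indicator) auto
    also have "\<dots> = (LINT x:A|lborel. h x)"
      by (simp add: integral_completion set_lebesgue_integral_def)
    finally show ?thesis .
  qed
  have h_int: "integrable lborel h"
  proof -
    have "integrable lebesgue h"
      using g_int integrable_cong_AE[OF meas gh'] by simp
    then show ?thesis using integrable_completion[OF h] by simp
  qed
  have h_set: "set_integrable lborel A h" if "A \<in> sets borel" for A
    using integrable_mult_indicator[of A lborel h] that h_int by (simp add: set_integrable_def)
  \<comment> \<open>Total mass zero handles complements in the induction over the generated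
    sigma-algebra; it is a box integral because \<open>g\<close> is supported in
    \<open>box a b\<close>.\<close>
  have h_UNIV: "(LINT x:UNIV|lborel. h x) = 0"
  proof -
    have "(LINT x|lebesgue. indicator UNIV x * g x) = (LINT x|lebesgue. indicator (box a b) x * g x)"
      by (intro Bochner_Integration.integral_cong) (auto simp: g_def split: split_indicator)
    then show ?thesis using g_box[of a b] transfer[of UNIV] by simp
  qed
  have h_zero: "(LINT x:A|lborel. h x) = 0" if "A \<in> sets borel" for A
  proof -
    have A: "A \<in> sigma_sets UNIV (range (\<lambda>(a, b). box a b :: (real ^ 'n) set))"
      using that by (simp add: borel_eq_box)
    have "Int_stable (range (\<lambda>(a, b). box a b :: (real ^ 'n) set))"
    proof (rule Int_stableI)
      fix A B :: "(real ^ 'n) set"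
      assume "A \<in> range (\<lambda>(a, b). box a b)" "B \<in> range (\<lambda>(a, b). box a b)"
      then obtain a b c e where "A = box a b" "B = box c e" by auto
      then have "A \<inter> B = (case (\<Sum>i\<in>Basis. max (a \<bullet> i) (c \<bullet> i) *\<^sub>R i, \<Sum>i\<in>Basis. min (b \<bullet> i) (e \<bullet> i) *\<^sub>R i)
          of (a, b) \<Rightarrow> box a b)"
        by (simp add: box_Int_box)
      then show "A \<inter> B \<in> range (\<lambda>(a, b). box a b)" by (rule range_eqI)
    qed
    moreover have "range (\<lambda>(a, b). box a b :: (real ^ 'n) set) \<subseteq> Pow UNIV" by simp
    ultimately show ?thesis
      using A
    proof (induction rule: sigma_sets_induct_disjoint)
      case (basic A)
      then obtain c e where "A = box c e" by auto
      then show ?case using g_box[of c e] transfer[of "box c e"] by simp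
    next
      case (compl A)
      then have A: "A \<in> sets borel" by (simp add: borel_eq_box)
      have "(LINT x:A \<union> (UNIV - A)|lborel. h x) = (LINT x:A|lborel. h x) + (LINT x:UNIV - A|lborel. h x)"
        using A by (intro set_integral_Un h_set) auto
      then show ?case using compl h_UNIV by simp
    next
      case (union A)
      then have A: "A i \<in> sets borel" for i by (auto simp: borel_eq_box)
      have "(LINT x:(\<Union>i. A i)|lborel. h x) = (\<Sum>i. (LINT x:A i|lborel. h x))"
        using union(1) A by (intro lebesgue_integral_countable_add h_set) (auto simp: disjoint_family_on_def)
      then show ?case using union by simp
    qed (auto simp: set_lebesgue_integral_def)
  qed
  have "AE x in lborel. h x = 0"
    using h_int h_zero by (intro density_unique_real) (auto simp: set_lebesgue_integral_def)
  then have "AE x in lebesgue. h x = 0" by (rule AE_completion)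
  with gh' show ?thesis by eventually_elim (auto simp: g_def)
qed

text \<open>By the Lindelof property countably many admissible boxes cover \<open>\<Omega>\<close>,
  so the exceptional null sets of the boxes add up to a null set.\<close>

lemma fundamental_lemma:
  fixes d :: "real ^ 'n::finite \<Rightarrow> real"
  assumes d: "d \<in> L2 \<Omega>" and "open \<Omega>"
    and zero: "\<And>\<psi>. \<psi> \<in> test_functions \<Omega> \<Longrightarrow> (LINT x|lebesgue_on \<Omega>. d x * \<psi> x) = 0"
  shows "AE x in lebesgue_on \<Omega>. d x = 0"
proof -
  have "\<Omega> \<in> sets lebesgue" using \<open>open \<Omega>\<close> by auto
  define F where "F = {box a b | a b :: real ^ 'n. cbox a b \<subseteq> \<Omega>}"
  have "\<Omega> \<subseteq> \<Union>F"
  proof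
    fix x assume "x \<in> \<Omega>"
    then obtain a b where "x \<in> box a b" "cbox a b \<subseteq> \<Omega>"
      using open_contains_cbox[THEN iffD1, OF \<open>open \<Omega>\<close>] by metis
    then show "x \<in> \<Union>F" by (auto simp: F_def)
  qed
  obtain F' where F': "F' \<subseteq> F" "countable F'" "\<Union>F' = \<Union>F"
    by (rule Lindelof[of F]) (auto simp: F_def)
  have "AE x in lebesgue. x \<in> B \<longrightarrow> d x = 0" if "B \<in> F'" for B
    using that F'(1) AE_box_eq_0[OF assms(1,2) _ zero] by (auto simp: F_def)
  then have "AE x in lebesgue. \<forall>B\<in>F'. x \<in> B \<longrightarrow> d x = 0"
    using AE_ball_countable[OF F'(2), of "\<lambda>x B. x \<in> B \<longrightarrow> d x = 0"] by blast
  then have "AE x in lebesgue. x \<in> \<Omega> \<longrightarrow> d x = 0"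
    by eventually_elim (use \<open>\<Omega> \<subseteq> \<Union>F\<close> F' in blast)
  then show ?thesis
    using \<open>\<Omega> \<in> sets lebesgue\<close> by (simp add: AE_restrict_space_iff)
qed

lemma L2_diff:
  fixes f g :: "real ^ 'n::finite \<Rightarrow> real"
  assumes "f \<in> L2 \<Omega>" "g \<in> L2 \<Omega>"
  shows "(\<lambda>x. f x - g x) \<in> L2 \<Omega>"
proof -
  have "integrable (lebesgue_on \<Omega>) (\<lambda>x. (f x)\<^sup>2 + (g x)\<^sup>2 - 2 * (f x * g x))"
    using assms L2_mult_integrable[OF assms] by (simp add: L2_def)
  then show ?thesis
    using assms by (auto simp: L2_def power2_diff algebra_simps)
qed

text \<open>Makes the \<open>SOME\<close> in \<open>weak_gradient\<close> harmless: any gradient at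
  hand may replace the chosen one under an integral.\<close>

lemma weak_gradient_unique:
  fixes G :: "real ^ 'n::finite \<Rightarrow> real ^ 'n"
  assumes "has_weak_gradient \<Omega> u G" "has_weak_gradient \<Omega> u H" "open \<Omega>"
  shows "AE x in lebesgue_on \<Omega>. G x = H x"
proof -
  have L2: "G \<in> L2 \<Omega>" "H \<in> L2 \<Omega>" using assms by (auto simp: has_weak_gradient_def)
  have "AE x in lebesgue_on \<Omega>. G x $ i - H x $ i = 0" for i
  proof (rule fundamental_lemma[OF _ \<open>open \<Omega>\<close>])
    show "(\<lambda>x. G x $ i - H x $ i) \<in> L2 \<Omega>" by (intro L2_diff L2_vec_nth L2)
    fix \<psi> assume \<psi>: "\<psi> \<in> test_functions \<Omega>"
    have "integrable (lebesgue_on \<Omega>) (\<lambda>x. G x $ i * \<psi> x)" "integrable (lebesgue_on \<Omega>) (\<lambda>x. H x $ i * \<psi> x)"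
      by (intro L2_mult_integrable L2_vec_nth L2 test_functions_L2 \<psi> \<open>open \<Omega>\<close>)+
    moreover have "(LINT x|lebesgue_on \<Omega>. G x $ i * \<psi> x) = (LINT x|lebesgue_on \<Omega>. H x $ i * \<psi> x)"
    proof -
      have "- (LINT x|lebesgue_on \<Omega>. G x $ i * \<psi> x) = - (LINT x|lebesgue_on \<Omega>. H x $ i * \<psi> x)"
        using assms(1,2) \<psi> by (simp add: has_weak_gradient_def)
      then show ?thesis by simp
    qed
    ultimately show "(LINT x|lebesgue_on \<Omega>. (G x $ i - H x $ i) * \<psi> x) = 0"
      by (simp add: left_diff_distrib)
  qed
  then have "AE x in lebesgue_on \<Omega>. \<forall>i. G x $ i - H x $ i = 0"
    by (simp add: AE_all_countable)
  then show ?thesis by eventually_elim (simp add: vec_eq_iff)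
qed

section \<open>Perturbation of a local minimizer by a test function\<close>

lemma integral_lebesgue_on_mono:
  fixes f :: "'a::euclidean_space \<Rightarrow> real"
  assumes "\<And>x. x \<notin> \<Omega>' \<Longrightarrow> f x = 0" "\<Omega>' \<subseteq> \<Omega>" "\<Omega>' \<in> sets lebesgue" "\<Omega> \<in> sets lebesgue"
  shows "(LINT x|lebesgue_on \<Omega>. f x) = (LINT x|lebesgue_on \<Omega>'. f x)"
proof -
  have "indicator \<Omega> x *\<^sub>R f x = f x" "indicator \<Omega>' x *\<^sub>R f x = f x" for x
    using assms(1)[of x] assms(2) by (cases "x \<in> \<Omega>'"; auto)+
  then show ?thesis
    using assms(3,4) by (simp add: integral_restrict_space del: real_scaleR_def)
qed

lemma L2_subset:
  assumes f: "f \<in> L2 \<Omega>" and "\<Omega>' \<subseteq> \<Omega>" "open \<Omega>" "open \<Omega>'"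
  shows "f \<in> L2 \<Omega>'"
proof -
  have sets: "\<Omega>' \<in> sets lebesgue" "\<Omega> \<in> sets lebesgue" using assms by auto
  let ?g = "\<lambda>x. indicator \<Omega> x *\<^sub>R (norm (f x))\<^sup>2"
  have "integrable lebesgue ?g"
    using f sets by (simp add: L2_def integrable_restrict_space del: real_scaleR_def)
  then have "integrable lebesgue (\<lambda>x. indicator \<Omega>' x *\<^sub>R ?g x)"
    by (rule integrable_mult_indicator[OF sets(1)])
  also have "(\<lambda>x. indicator \<Omega>' x *\<^sub>R ?g x) = (\<lambda>x. indicator \<Omega>' x *\<^sub>R (norm (f x))\<^sup>2)"
    using \<open>\<Omega>' \<subseteq> \<Omega>\<close> by (auto simp: fun_eq_iff split: split_indicator)
  finally have "integrable (lebesgue_on \<Omega>') (\<lambda>x. (norm (f x))\<^sup>2)"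
    using sets by (simp add: integrable_restrict_space del: real_scaleR_def)
  moreover have "f \<in> borel_measurable (lebesgue_on \<Omega>')"
    using f \<open>\<Omega>' \<subseteq> \<Omega>\<close> by (auto simp: L2_def intro: measurable_restrict_mono)
  ultimately show ?thesis by (simp add: L2_def)
qed

text \<open>Minimality is tested on small balls, where the energy refers to the weak gradient
  relative to the ball; one gradient of \<open>u\<close> on the large set serves for all of
  them.\<close>

lemma has_weak_gradient_subset:
  assumes G: "has_weak_gradient \<Omega> u G" and "\<Omega>' \<subseteq> \<Omega>" "open \<Omega>" "open \<Omega>'"
  shows "has_weak_gradient \<Omega>' u G"
  unfolding has_weak_gradient_def
proof (intro conjI ballI allI)
  show "u \<in> L2 \<Omega>'" "G \<in> L2 \<Omega>'"
    using assms by (auto simp: has_weak_gradient_def intro: L2_subset)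
  fix \<psi> i assume \<psi>: "\<psi> \<in> test_functions \<Omega>'"
  have sets: "\<Omega>' \<in> sets lebesgue" "\<Omega> \<in> sets lebesgue" using assms by auto
  have "(LINT x|lebesgue_on \<Omega>'. u x * partial_deriv i \<psi> x) = (LINT x|lebesgue_on \<Omega>. u x * partial_deriv i \<psi> x)"
    using test_functions_eq_0[OF test_functions_partial_deriv[OF \<psi>]] sets \<open>\<Omega>' \<subseteq> \<Omega>\<close>
    by (intro integral_lebesgue_on_mono[symmetric]) auto
  also have "\<dots> = - (LINT x|lebesgue_on \<Omega>. G x $ i * \<psi> x)"
    using G test_functions_mono[OF \<psi> \<open>\<Omega>' \<subseteq> \<Omega>\<close>] by (simp add: has_weak_gradient_def)
  also have "(LINT x|lebesgue_on \<Omega>. G x $ i * \<psi> x) = (LINT x|lebesgue_on \<Omega>'. G x $ i * \<psi> x)"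
    using test_functions_eq_0[OF \<psi>] sets \<open>\<Omega>' \<subseteq> \<Omega>\<close>
    by (intro integral_lebesgue_on_mono) auto
  finally show "(LINT x|lebesgue_on \<Omega>'. u x * partial_deriv i \<psi> x) = - (LINT x|lebesgue_on \<Omega>'. G x $ i * \<psi> x)" .
qed

lemma norm_vec_power2: "(norm (v :: real ^ 'n::finite))\<^sup>2 = (\<Sum>i\<in>UNIV. (v $ i)\<^sup>2)"
  unfolding power2_norm_eq_inner inner_vec_def by (simp add: power2_eq_square)

lemma has_weak_gradient_test_function:
  assumes \<psi>: "\<psi> \<in> test_functions \<Omega>" and "open \<Omega>"
  shows "has_weak_gradient \<Omega> \<psi> (\<lambda>x. \<chi> i. partial_deriv i \<psi> x)"
  unfolding has_weak_gradient_def
proof (intro conjI ballI allI)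
  have L2: "partial_deriv i \<psi> \<in> L2 \<Omega>" for i
    using \<psi> \<open>open \<Omega>\<close> by (intro test_functions_L2 test_functions_partial_deriv)
  show "(\<lambda>x. \<chi> i. partial_deriv i \<psi> x) \<in> L2 \<Omega>"
    unfolding L2_def
  proof (intro CollectI conjI)
    show "(\<lambda>x. \<chi> i. partial_deriv i \<psi> x) \<in> borel_measurable (lebesgue_on \<Omega>)"
      using L2 by (subst borel_measurable_euclidean_space) (auto simp: Basis_vec_def inner_axis L2_def)
    show "integrable (lebesgue_on \<Omega>) (\<lambda>x. (norm (\<chi> i. partial_deriv i \<psi> x))\<^sup>2)"
      using L2 by (simp add: norm_vec_power2 L2_def)
  qed
  fix \<eta> i assume "\<eta> \<in> test_functions \<Omega>"
  then show "(LINT x|lebesgue_on \<Omega>. \<psi> x * partial_deriv i \<eta> x) =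
      - (LINT x|lebesgue_on \<Omega>. (\<chi> i. partial_deriv i \<psi> x) $ i * \<eta> x)"
    using integration_by_parts_test_functions[OF \<psi> _ \<open>open \<Omega>\<close>] by simp
qed (rule test_functions_L2[OF assms])

lemma L2_add:
  fixes f g :: "real ^ 'n::finite \<Rightarrow> 'b::euclidean_space"
  assumes "f \<in> L2 \<Omega>" "g \<in> L2 \<Omega>"
  shows "(\<lambda>x. f x + g x) \<in> L2 \<Omega>"
proof -
  have meas: "f \<in> borel_measurable (lebesgue_on \<Omega>)" "g \<in> borel_measurable (lebesgue_on \<Omega>)"
    using assms by (auto simp: L2_def)
  note meas [measurable]
  have "integrable (lebesgue_on \<Omega>) (\<lambda>x. (norm (f x + g x))\<^sup>2)"
  proof (rule Bochner_Integration.integrable_bound)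
    show "integrable (lebesgue_on \<Omega>) (\<lambda>x. 2 * (norm (f x))\<^sup>2 + 2 * (norm (g x))\<^sup>2)"
      using assms by (simp add: L2_def)
    show "AE x in lebesgue_on \<Omega>. norm ((norm (f x + g x))\<^sup>2) \<le> norm (2 * (norm (f x))\<^sup>2 + 2 * (norm (g x))\<^sup>2)"
    proof (rule AE_I2)
      fix x
      have "(norm (f x + g x))\<^sup>2 \<le> (norm (f x) + norm (g x))\<^sup>2"
        by (intro power_mono norm_triangle_ineq) auto
      also have "\<dots> \<le> 2 * (norm (f x))\<^sup>2 + 2 * (norm (g x))\<^sup>2"
        using sum_squares_bound[of "norm (f x)" "norm (g x)"] by (simp add: power2_sum)
      finally show "norm ((norm (f x + g x))\<^sup>2) \<le> norm (2 * (norm (f x))\<^sup>2 + 2 * (norm (g x))\<^sup>2)"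
        by simp
    qed
  qed measurable
  then show ?thesis by (simp add: L2_def)
qed

lemma has_weak_gradient_add:
  assumes "has_weak_gradient \<Omega> u G" "has_weak_gradient \<Omega> v H" "open \<Omega>"
  shows "has_weak_gradient \<Omega> (\<lambda>x. u x + v x) (\<lambda>x. G x + H x)"
  unfolding has_weak_gradient_def
proof (intro conjI ballI allI)
  have L2: "u \<in> L2 \<Omega>" "v \<in> L2 \<Omega>" "G \<in> L2 \<Omega>" "H \<in> L2 \<Omega>"
    using assms by (auto simp: has_weak_gradient_def)
  then show "(\<lambda>x. u x + v x) \<in> L2 \<Omega>" "(\<lambda>x. G x + H x) \<in> L2 \<Omega>" by (auto intro: L2_add)
  fix \<psi> i assume \<psi>: "\<psi> \<in> test_functions \<Omega>"
  have L2': "\<psi> \<in> L2 \<Omega>" "partial_deriv i \<psi> \<in> L2 \<Omega>"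
    using \<psi> \<open>open \<Omega>\<close> by (auto intro: test_functions_L2 test_functions_partial_deriv)
  have int: "integrable (lebesgue_on \<Omega>) (\<lambda>x. u x * partial_deriv i \<psi> x)" "integrable (lebesgue_on \<Omega>) (\<lambda>x. v x * partial_deriv i \<psi> x)"
    "integrable (lebesgue_on \<Omega>) (\<lambda>x. G x $ i * \<psi> x)" "integrable (lebesgue_on \<Omega>) (\<lambda>x. H x $ i * \<psi> x)"
    by (intro L2_mult_integrable L2_vec_nth L2 L2')+
  show "(LINT x|lebesgue_on \<Omega>. (u x + v x) * partial_deriv i \<psi> x) =
      - (LINT x|lebesgue_on \<Omega>. (G x + H x) $ i * \<psi> x)"
    using assms(1,2) \<psi> int by (simp add: has_weak_gradient_def distrib_right)
qed

lemma has_weak_gradient_zero: "has_weak_gradient \<Omega> (\<lambda>x. 0) (\<lambda>x. 0)"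
  by (simp add: has_weak_gradient_def L2_def)

lemma AE_weak_gradient:
  assumes "has_weak_gradient \<Omega> u G" "open \<Omega>"
  shows "AE x in lebesgue_on \<Omega>. weak_gradient \<Omega> u x = G x"
  unfolding weak_gradient_def
  by (rule weak_gradient_unique[OF someI[of "has_weak_gradient \<Omega> u", OF assms(1)] assms])

lemma weak_gradient_measurable:
  assumes "has_weak_gradient \<Omega> u G"
  shows "weak_gradient \<Omega> u \<in> borel_measurable (lebesgue_on \<Omega>)"
  using someI[of "has_weak_gradient \<Omega> u", OF assms]
  unfolding weak_gradient_def[symmetric] by (simp add: has_weak_gradient_def L2_def)

lemma test_functions_H1_0:
  assumes \<psi>: "\<psi> \<in> test_functions \<Omega>" and "open \<Omega>"
  shows "\<psi> \<in> H1_0 \<Omega>"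
proof -
  note weak_gradient_measurable[OF has_weak_gradient_zero, measurable]
  \<comment> \<open>The function approximates itself, but the distance still involves the chosen
    gradient of the zero function, which is 0 only almost everywhere.\<close>
  have "(LINT x|lebesgue_on \<Omega>. 0\<^sup>2 + (norm (weak_gradient \<Omega> (\<lambda>x. 0) x))\<^sup>2) = (LINT x|lebesgue_on \<Omega>. 0)"
    using AE_weak_gradient[OF has_weak_gradient_zero \<open>open \<Omega>\<close>]
    by (intro integral_cong_AE) auto
  then have "H1_norm \<Omega> (\<lambda>x. \<psi> x - \<psi> x) = 0"
    by (simp add: H1_norm_def)
  moreover have "\<psi> \<in> H1 \<Omega>"
    using has_weak_gradient_test_function[OF assms] by (auto simp: H1_def)
  ultimately show ?thesis using \<psi> by (force simp: H1_0_def)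
qed

section \<open>Energy comparison with a perturbed minimizer\<close>

lemma lebesgue_on_bounded_integral:
  fixes f :: "'a::euclidean_space \<Rightarrow> real"
  assumes "f \<in> borel_measurable (lebesgue_on \<Omega>)" "\<And>x. \<bar>f x\<bar> \<le> c" "\<Omega> \<in> lmeasurable"
  shows "integrable (lebesgue_on \<Omega>) f" "\<bar>LINT x|lebesgue_on \<Omega>. f x\<bar> \<le> c * measure lebesgue \<Omega>"
proof -
  interpret finite_measure "lebesgue_on \<Omega>"
    using assms(3) by (rule finite_measure_lebesgue_on)
  show int: "integrable (lebesgue_on \<Omega>) f"
    using assms by (intro integrable_const_bound[where B = c]) auto
  have "\<bar>LINT x|lebesgue_on \<Omega>. f x\<bar> \<le> (LINT x|lebesgue_on \<Omega>. \<bar>f x\<bar>)"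
    by (rule integral_abs_bound)
  also have "\<dots> \<le> (LINT x|lebesgue_on \<Omega>. c)"
    using int assms(2) by (intro integral_mono) auto
  also have "\<dots> = c * measure lebesgue \<Omega>"
    using assms(3) by (simp add: measure_restrict_space fmeasurableD)
  finally show "\<bar>LINT x|lebesgue_on \<Omega>. f x\<bar> \<le> c * measure lebesgue \<Omega>" .
qed

lemma energy_eq:
  assumes G: "has_weak_gradient \<Omega> v G" and "open \<Omega>" and int: "integrable (lebesgue_on \<Omega>) (\<lambda>x. \<sigma> (v x))"
  shows "energy \<sigma> v \<Omega> = 1 / 2 * (LINT x|lebesgue_on \<Omega>. (norm (G x))\<^sup>2) + (LINT x|lebesgue_on \<Omega>. \<sigma> (v x))"
proof -
  have meas: "G \<in> borel_measurable (lebesgue_on \<Omega>)" and G2: "integrable (lebesgue_on \<Omega>) (\<lambda>x. (norm (G x))\<^sup>2)"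
    using G by (auto simp: has_weak_gradient_def L2_def)
  note [measurable] = weak_gradient_measurable[OF G] meas borel_measurable_integrable[OF int]
  have "energy \<sigma> v \<Omega> = (LINT x|lebesgue_on \<Omega>. 1 / 2 * (norm (G x))\<^sup>2 + \<sigma> (v x))"
    unfolding energy_def using AE_weak_gradient[OF G \<open>open \<Omega>\<close>]
    by (intro integral_cong_AE) auto
  also have "\<dots> = 1 / 2 * (LINT x|lebesgue_on \<Omega>. (norm (G x))\<^sup>2) + (LINT x|lebesgue_on \<Omega>. \<sigma> (v x))"
    using int G2 by simp
  finally show ?thesis .
qed

definition laplacian :: "(real ^ 'n::finite \<Rightarrow> real) \<Rightarrow> real ^ 'n \<Rightarrow> real" where
  "laplacian \<psi> x = (\<Sum>i\<in>UNIV. partial_deriv i (partial_deriv i \<psi>) x)"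

text \<open>Expanding the square of the gradient of u + \<psi> leaves a cross term. Taking the i-th
  derivative of \<psi> as test function in the definition of the weak gradient turns it into minus
  the pairing of u with the Laplacian. Each of the two potential integrals is at most
  \<open>c\<close> times the volume in absolute value, hence the factor 2.\<close>

lemma local_minimizer_laplacian_le:
  fixes u :: "real ^ 'n::finite \<Rightarrow> real"
  assumes min: "local_minimizer \<sigma> \<Omega>\<^sub>0 u" and \<sigma>: "\<sigma> \<in> borel_measurable borel" "\<And>t. \<bar>\<sigma> t\<bar> \<le> c"
    and \<Omega>: "open \<Omega>\<^sub>0" "open \<Omega>" "\<Omega> \<subseteq> \<Omega>\<^sub>0" "bounded \<Omega>" and \<psi>: "\<psi> \<in> test_functions \<Omega>"
  shows "(LINT x|lebesgue_on \<Omega>. u x * laplacian \<psi> x) \<le>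
    1 / 2 * (LINT x|lebesgue_on \<Omega>. (\<Sum>i\<in>UNIV. (partial_deriv i \<psi> x)\<^sup>2)) + 2 * c * measure lebesgue \<Omega>"
proof -
  have lm: "\<Omega> \<in> lmeasurable" using \<Omega> by (simp add: lmeasurable_open)
  obtain G where "has_weak_gradient \<Omega>\<^sub>0 u G"
    using min by (auto simp: local_minimizer_def H1_def)
  then have G: "has_weak_gradient \<Omega> u G" using \<Omega> by (blast intro: has_weak_gradient_subset)
  define H where "H x = (\<chi> i. partial_deriv i \<psi> x)" for x
  have H: "has_weak_gradient \<Omega> \<psi> H"
    unfolding H_def using \<psi> \<Omega>(2) by (rule has_weak_gradient_test_function)
  note GH = has_weak_gradient_add[OF G H \<Omega>(2)]
  have "(\<lambda>x. u x + \<psi> x) \<in> H1 \<Omega>" using GH by (auto simp: H1_def)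
  moreover have "(\<lambda>x. (u x + \<psi> x) - u x) \<in> H1_0 \<Omega>"
    using test_functions_H1_0[OF \<psi> \<Omega>(2)] by simp
  ultimately have le: "energy \<sigma> u \<Omega> \<le> energy \<sigma> (\<lambda>x. u x + \<psi> x) \<Omega>"
    using min \<Omega> by (auto simp: local_minimizer_def)
  have \<sigma>_int: "integrable (lebesgue_on \<Omega>) (\<lambda>x. \<sigma> (v x))"
    "\<bar>LINT x|lebesgue_on \<Omega>. \<sigma> (v x)\<bar> \<le> c * measure lebesgue \<Omega>"
    if "has_weak_gradient \<Omega> v F" for v F
  proof -
    have "(\<lambda>x. \<sigma> (v x)) \<in> borel_measurable (lebesgue_on \<Omega>)"
      using that by (intro measurable_compose[OF _ \<sigma>(1)]) (auto simp: has_weak_gradient_def L2_def)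
    then show "integrable (lebesgue_on \<Omega>) (\<lambda>x. \<sigma> (v x))"
      "\<bar>LINT x|lebesgue_on \<Omega>. \<sigma> (v x)\<bar> \<le> c * measure lebesgue \<Omega>"
      using \<sigma>(2) lm by (auto intro: lebesgue_on_bounded_integral)
  qed
  have L2: "u \<in> L2 \<Omega>" "G \<in> L2 \<Omega>" "H \<in> L2 \<Omega>"
    using G H by (auto simp: has_weak_gradient_def)
  have D: "partial_deriv i \<psi> \<in> test_functions \<Omega>" for i
    using \<psi> by (rule test_functions_partial_deriv)
  have int_GH: "integrable (lebesgue_on \<Omega>) (\<lambda>x. G x $ i * partial_deriv i \<psi> x)" for i
    by (intro L2_mult_integrable L2_vec_nth L2 test_functions_L2 D \<Omega>(2))
  have int_u: "integrable (lebesgue_on \<Omega>) (\<lambda>x. u x * partial_deriv i (partial_deriv i \<psi>) x)" for i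
    by (intro L2_mult_integrable L2 test_functions_L2 test_functions_partial_deriv D \<Omega>(2))
  have inner: "G x \<bullet> H x = (\<Sum>i\<in>UNIV. G x $ i * partial_deriv i \<psi> x)" for x
    by (simp add: inner_vec_def H_def)
  have "(LINT x|lebesgue_on \<Omega>. G x \<bullet> H x) = (\<Sum>i\<in>UNIV. LINT x|lebesgue_on \<Omega>. G x $ i * partial_deriv i \<psi> x)"
    using int_GH by (simp add: inner)
  also have "\<dots> = (\<Sum>i\<in>UNIV. - (LINT x|lebesgue_on \<Omega>. u x * partial_deriv i (partial_deriv i \<psi>) x))"
    using G D by (intro sum.cong) (auto simp: has_weak_gradient_def)
  also have "\<dots> = - (LINT x|lebesgue_on \<Omega>. u x * laplacian \<psi> x)"
    using int_u by (simp add: laplacian_def sum_distrib_left sum_negf)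
  finally have GH_eq: "(LINT x|lebesgue_on \<Omega>. G x \<bullet> H x) = - (LINT x|lebesgue_on \<Omega>. u x * laplacian \<psi> x)" .
  have "(LINT x|lebesgue_on \<Omega>. (norm (G x + H x))\<^sup>2) =
      (LINT x|lebesgue_on \<Omega>. (norm (G x))\<^sup>2 + 2 * (G x \<bullet> H x) + (norm (H x))\<^sup>2)"
    by (simp add: power2_norm_eq_inner inner_add_left inner_add_right inner_commute algebra_simps)
  also have "\<dots> = (LINT x|lebesgue_on \<Omega>. (norm (G x))\<^sup>2) + 2 * (LINT x|lebesgue_on \<Omega>. G x \<bullet> H x)
      + (LINT x|lebesgue_on \<Omega>. (norm (H x))\<^sup>2)"
    using L2 int_GH by (simp add: L2_def inner)
  finally have expand: "(LINT x|lebesgue_on \<Omega>. (norm (G x + H x))\<^sup>2) =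
      (LINT x|lebesgue_on \<Omega>. (norm (G x))\<^sup>2) - 2 * (LINT x|lebesgue_on \<Omega>. u x * laplacian \<psi> x)
      + (LINT x|lebesgue_on \<Omega>. (norm (H x))\<^sup>2)"
    by (simp add: GH_eq)
  have "(norm (H x))\<^sup>2 = (\<Sum>i\<in>UNIV. (partial_deriv i \<psi> x)\<^sup>2)" for x
    by (simp add: norm_vec_power2 H_def)
  with expand have expand': "(LINT x|lebesgue_on \<Omega>. (norm (G x + H x))\<^sup>2) =
      (LINT x|lebesgue_on \<Omega>. (norm (G x))\<^sup>2) - 2 * (LINT x|lebesgue_on \<Omega>. u x * laplacian \<psi> x)
      + (LINT x|lebesgue_on \<Omega>. (\<Sum>i\<in>UNIV. (partial_deriv i \<psi> x)\<^sup>2))"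
    by simp
  show ?thesis
    using le[unfolded energy_eq[OF G \<Omega>(2) \<sigma>_int(1)[OF G]] energy_eq[OF GH \<Omega>(2) \<sigma>_int(1)[OF GH]]]
      expand' abs_le_D2[OF \<sigma>_int(2)[OF G]] abs_le_D1[OF \<sigma>_int(2)[OF GH]]
    by linarith
qed

section \<open>Averages against the kernel\<close>

text \<open>A quadratic polynomial in \<open>x\<close>, so the barrier is smooth at the centre as
  well; it is positive exactly in the open ball of radius \<open>r\<close> when
  \<open>r > 0\<close>.\<close>

definition profile :: "real ^ 'n::finite \<Rightarrow> real \<Rightarrow> real ^ 'n \<Rightarrow> real" where
  "profile y r x = 1 - (norm (x - y))\<^sup>2 / r\<^sup>2"

definition barrier :: "real ^ 'n::finite \<Rightarrow> real \<Rightarrow> real ^ 'n \<Rightarrow> real" where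
  "barrier y r x = bump 0 (profile y r x)"

definition kern :: "real ^ 'n::finite \<Rightarrow> real \<Rightarrow> real ^ 'n \<Rightarrow> real" where
  "kern y r x = bump 2 (profile y r x) / r ^ CARD('n)"

lemma profile_le_0: "r > 0 \<Longrightarrow> x \<notin> cball y r \<Longrightarrow> profile y r x \<le> 0"
  by (auto simp: profile_def dist_norm norm_minus_commute intro!: power_mono)

lemma profile_le_1: "profile y r x \<le> 1"
  by (simp add: profile_def)

lemma profile_ge:
  assumes "norm (x - y) \<le> a * r" "r > 0" "a \<ge> 0"
  shows "profile y r x \<ge> 1 - a\<^sup>2"
proof -
  have "(norm (x - y))\<^sup>2 \<le> (a * r)\<^sup>2" using assms by (intro power_mono) auto
  then show ?thesis using assms by (simp add: profile_def divide_le_eq power_mult_distrib)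
qed

lemma smooth_profile: "profile y r \<in> smooth"
proof -
  have "profile y r = (\<lambda>x. 1 - (\<Sum>i\<in>UNIV. (x $ i - y $ i) * (x $ i - y $ i)) * (1 / r\<^sup>2))"
    by (simp add: fun_eq_iff profile_def norm_vec_power2 flip: power2_eq_square)
  then show ?thesis
    by (simp only:)
      (intro smooth_diff smooth_const smooth_mult smooth_sum smooth_component)
qed

lemma smooth_barrier: "barrier y r \<in> smooth"
  unfolding barrier_def[abs_def] by (intro smooth_bump smooth_profile)

lemma partial_deriv_profile: "partial_deriv i (profile y r) x = - 2 * (x $ i - y $ i) / r\<^sup>2"
proof -
  have "(profile y r has_derivative (\<lambda>h. - (2 * ((x - y) \<bullet> h)) / r\<^sup>2)) (at x)"
    unfolding profile_def[abs_def] power2_norm_eq_inner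
    by (auto intro!: derivative_eq_intros simp: inner_commute divide_inverse algebra_simps)
  from partial_deriv_eqI[OF this, of i] show ?thesis
    by (simp add: inner_axis)
qed

lemma partial_deriv_barrier:
  "partial_deriv i (barrier y r) x = - 2 / r\<^sup>2 * (x $ i - y $ i) * bump 2 (profile y r x)"
  unfolding barrier_def[abs_def]
  by (simp add: partial_deriv_bump[OF smooth_differentiable[OF smooth_profile]] partial_deriv_profile
      diff_divide_distrib algebra_simps flip: numeral_2_eq_2)

lemma laplacian_barrier:
  fixes y :: "real ^ 'n::finite"
  shows "laplacian (barrier y r) x =
    4 * (norm (x - y))\<^sup>2 / r ^ 4 * (bump 4 (profile y r x) - 2 * bump 3 (profile y r x))
    - 2 * real CARD('n) / r\<^sup>2 * bump 2 (profile y r x)"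
proof -
  let ?B = "\<lambda>k. bump k (profile y r x)"
  have "partial_deriv i (partial_deriv i (barrier y r)) x =
      4 * (x $ i - y $ i)\<^sup>2 / r ^ 4 * (?B 4 - 2 * ?B 3) - 2 / r\<^sup>2 * ?B 2" for i
  proof -
    let ?l = "\<lambda>x :: real ^ 'n. - 2 / r\<^sup>2 * (x $ i - y $ i)"
    have l: "(?l has_derivative (\<lambda>h. - 2 / r\<^sup>2 * (h $ i))) (at x)"
      by (rule has_derivative_eq_rhs, rule has_derivative_mult_right[OF has_derivative_diff[OF
              bounded_linear_imp_has_derivative[OF bounded_linear_vec_nth[of i]] has_derivative_const]]) simp
    have "partial_deriv i (barrier y r) = (\<lambda>x. ?l x * bump 2 (profile y r x))"
      by (rule ext) (rule partial_deriv_barrier)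
    moreover have "partial_deriv i (\<lambda>x. ?l x * bump 2 (profile y r x)) x =
        ?l x * partial_deriv i (\<lambda>x. bump 2 (profile y r x)) x + partial_deriv i ?l x * ?B 2"
      using l by (intro partial_deriv_mult smooth_differentiable[OF smooth_bump[OF smooth_profile]])
        (auto simp: differentiable_def)
    moreover have "partial_deriv i (\<lambda>x. bump 2 (profile y r x)) x =
        - 2 * (x $ i - y $ i) / r\<^sup>2 * (?B 4 - 2 * ?B 3)"
      by (simp add: partial_deriv_bump[OF smooth_differentiable[OF smooth_profile]] partial_deriv_profile)
    moreover have "partial_deriv i ?l x = - 2 / r\<^sup>2"
      using partial_deriv_eqI[OF l, of i] by simp
    moreover have "- 2 / r\<^sup>2 * d * (- 2 * d / r\<^sup>2 * a) + - 2 / r\<^sup>2 * b =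
        4 * d\<^sup>2 / r ^ 4 * a - 2 / r\<^sup>2 * b" for a b d :: real
      by (simp add: power2_eq_square power4_eq_xxxx)
    ultimately show ?thesis by (simp only:)
  qed
  then show ?thesis
    by (simp add: laplacian_def sum_subtractf norm_vec_power2 flip: sum_distrib_left sum_distrib_right sum_divide_distrib)
qed

text \<open>Any kernel of the form K = t^(-n) f ((x - y) / t) has t-derivative - (1 / t) div ((x -
  y) K). As the derivative of \<open>bump 0\<close> is \<open>bump 2\<close>, the gradient of the
  barrier is - 2 t^(n-2) (x - y) K, so its Laplacian is 2 t^(n-1) times the t-derivative of K. The
  proof checks this by direct computation.\<close>

lemma has_real_derivative_kern:
  fixes y :: "real ^ 'n::finite"
  assumes "t > 0"
  shows "((\<lambda>t. kern y t x) has_real_derivative laplacian (barrier y t) x * t / (2 * t ^ CARD('n))) (at t)"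
proof -
  let ?n = "CARD('n)" and ?B = "\<lambda>k. bump k (profile y t x)"
  have n: "t ^ ?n = t * t ^ (?n - 1)" by (metis Suc_pred' power_Suc zero_less_card_finite)
  have "((\<lambda>t. profile y t x) has_real_derivative 2 * (norm (x - y))\<^sup>2 / t ^ 3) (at t)"
    unfolding profile_def using assms
    by (auto intro!: derivative_eq_intros simp: power2_eq_square power3_eq_cube mult_ac)
  from DERIV_chain2[OF has_real_derivative_bump[of 2 "profile y t x"] this]
  have "((\<lambda>t. bump 2 (profile y t x)) has_real_derivative
      (?B 4 - 2 * ?B 3) * (2 * (norm (x - y))\<^sup>2 / t ^ 3)) (at t)"
    by simp
  then have "((\<lambda>t. kern y t x) has_real_derivative
      ((?B 4 - 2 * ?B 3) * (2 * (norm (x - y))\<^sup>2 / t ^ 3) * t ^ ?n - ?B 2 * (real ?n * t ^ (?n - 1))) / (t ^ ?n * t ^ ?n)) (at t)"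
    unfolding kern_def using assms by (auto intro!: derivative_eq_intros)
  also have "((?B 4 - 2 * ?B 3) * (2 * (norm (x - y))\<^sup>2 / t ^ 3) * t ^ ?n - ?B 2 * (real ?n * t ^ (?n - 1))) / (t ^ ?n * t ^ ?n)
      = laplacian (barrier y t) x * t / (2 * t ^ ?n)"
    using assms unfolding laplacian_barrier n
    by (simp add: field_simps power2_eq_square power3_eq_cube power4_eq_xxxx)
  finally show ?thesis .
qed

section \<open>Pointwise bounds for the kernel\<close>

lemma bump_2_le: "t \<le> 1 \<Longrightarrow> bump 2 t \<le> 6"
  using bump_le_linear[of t 2] by (cases "t \<ge> 0") (auto simp: bump_def fact_numeral)

lemma bump_2_ge: "1 / 4 \<le> t \<Longrightarrow> t \<le> 1 \<Longrightarrow> exp (- 4) \<le> bump 2 t"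
proof -
  assume t: "1 / 4 \<le> t" "t \<le> 1"
  have "exp (- 4) * t\<^sup>2 \<le> exp (- 4) * 1"
    using t by (intro mult_left_mono) (auto simp: power_le_one)
  also have "\<dots> \<le> exp (- (1 / t))" using t by (simp add: field_simps)
  finally show ?thesis using t by (simp add: bump_def field_simps)
qed

lemma kern_nonneg: "r > 0 \<Longrightarrow> kern y r x \<ge> 0"
  by (simp add: kern_def bump_nonneg)

lemma kern_eq_0: "r > 0 \<Longrightarrow> x \<notin> cball y r \<Longrightarrow> kern y r x = 0"
  using profile_le_0[of r x y] by (simp add: kern_def bump_eq_0_iff)

lemma kern_le: "r > 0 \<Longrightarrow> kern y r x \<le> 6 / r ^ CARD('n)" for y :: "real ^ 'n::finite"
  unfolding kern_def by (intro divide_right_mono bump_2_le profile_le_1) auto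

text \<open>The ratio 5/6 is the one needed when kernels at two centres are compared: a ball of
  radius d / 4 around a point at distance d from x0 reaches distance 5 d / 4, which is 5/6 of 3 d /
  2. It is admissible because 1 - 25/36 = 11/36 exceeds the threshold 1/4.\<close>

lemma kern_ge:
  fixes y :: "real ^ 'n::finite"
  assumes "norm (x - y) \<le> 5 / 6 * r" "r > 0"
  shows "exp (- 4) / r ^ CARD('n) \<le> kern y r x"
  unfolding kern_def
proof (intro divide_right_mono bump_2_ge profile_le_1)
  show "1 / 4 \<le> profile y r x"
    using profile_ge[OF assms(1,2)] by (simp add: power2_eq_square)
qed (use assms in auto)

lemma continuous_on_kern: "r > 0 \<Longrightarrow> continuous_on S (kern y r)"
  unfolding kern_def[abs_def] profile_def by (intro continuous_intros) auto

lemma continuous_on_laplacian_barrier: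
  fixes y :: "real ^ 'n::finite"
  shows "continuous_on ({0<..} \<times> UNIV) (\<lambda>(t, x). laplacian (barrier y t) x)"
  unfolding laplacian_barrier case_prod_unfold profile_def
  by (intro continuous_intros) auto

lemma laplacian_barrier_eq_0: "r > 0 \<Longrightarrow> x \<notin> cball y r \<Longrightarrow> laplacian (barrier y r) x = 0"
  using profile_le_0[of r x y] bump_eq_0_iff[of _ "profile y r x"] by (simp add: laplacian_barrier)

text \<open>The kernel is not normalized to mass 1: its mass lies between
  \<open>exp (- 4) / 2 ^ n\<close> and 6 times the volume of the unit ball. The integral runs over
  the whole space, but for \<open>r > 0\<close> only values of \<open>u\<close> in
  \<open>cball y r\<close> matter.\<close>

definition kern_mean :: "(real ^ 'n::finite \<Rightarrow> real) \<Rightarrow> real ^ 'n \<Rightarrow> real \<Rightarrow> real" where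
  "kern_mean u y r = (LINT x|lebesgue. u x * kern y r x)"

text \<open>The Leibniz rule asks for continuity on a box, which may stick out of the domain of
  \<open>u\<close>; composing with the nearest point projection onto the ball gives a continuous
  extension.\<close>

lemma continuous_extension_cball:
  fixes u :: "real ^ 'n::finite \<Rightarrow> real"
  assumes "continuous_on (cball y r) u" "r > 0"
  obtains v where "continuous_on UNIV v" "\<And>x. x \<in> cball y r \<Longrightarrow> v x = u x"
proof
  let ?p = "closest_point (cball y r)"
  have "?p x \<in> cball y r" for x
    using assms(2) by (intro closest_point_in_set) auto
  moreover have "continuous_on UNIV ?p"
    using assms(2) by (intro continuous_on_closest_point) auto
  ultimately show "continuous_on UNIV (\<lambda>x. u (?p x))"
    by (intro continuous_on_compose2[OF assms(1)]) auto
qed (simp add: closest_point_self)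

lemma kern_mean_integrable:
  fixes u :: "real ^ 'n::finite \<Rightarrow> real"
  assumes "continuous_on (cball y r) u" "r > 0"
  shows "integrable lebesgue (\<lambda>x. u x * kern y r x)"
proof -
  obtain v where v: "continuous_on UNIV v" "\<And>x. x \<in> cball y r \<Longrightarrow> v x = u x"
    using continuous_extension_cball[OF assms] by blast
  obtain c where c: "cball y r \<subseteq> cbox (- c) c"
    using bounded_subset_cbox_symmetric[OF bounded_cball] by blast
  have eq: "(\<lambda>x. u x * kern y r x) = (\<lambda>x. v x * kern y r x)"
    using v(2) kern_eq_0[OF assms(2), of _ y] by fastforce
  have "integrable (lebesgue_on UNIV) (\<lambda>x. v x * kern y r x)"
    by (rule lebesgue_on_compact_support(1)[OF _ _ subset_UNIV c])
      (use assms(2) kern_eq_0 v(1) in \<open>auto intro!: continuous_intros continuous_on_kern\<close>)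
  then show ?thesis by (simp add: eq lebesgue_on_UNIV_eq)
qed

text \<open>The assumed bound has the power of t that cancels the factor t^(1-n) / 2 in the
  derivative of the kernel, so the mean has derivative at most B / 2 at every scale. The balls are
  enlarged by 4/3 so that the closed ball supporting the barrier is compact inside an open
  one.\<close>

lemma kern_mean_diff_le:
  fixes u :: "real ^ 'n::finite \<Rightarrow> real"
  assumes u: "continuous_on (cball y R) u" and s: "0 < s" "s \<le> R"
    and lap: "\<And>t. t \<in> {s..R} \<Longrightarrow>
      \<bar>LINT x|lebesgue_on (ball y (4 / 3 * t)). u x * laplacian (barrier y t) x\<bar> \<le> B * t ^ CARD('n) / t"
  shows "\<bar>kern_mean u y R - kern_mean u y s\<bar> \<le> B / 2 * (R - s)"
proof -
  have "R > 0" using s by simp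
  obtain v where v: "continuous_on UNIV v" "\<And>x. x \<in> cball y R \<Longrightarrow> v x = u x"
    using continuous_extension_cball[OF u \<open>R > 0\<close>] by blast
  obtain c where c: "cball y R \<subseteq> cbox (- c) c"
    using bounded_subset_cbox_symmetric[OF bounded_cball] by blast
  define A where "A t = integral (cbox (- c) c) (\<lambda>x. v x * kern y t x)" for t
  have A: "kern_mean u y t = A t" if t: "t \<in> {s..R}" for t
  proof -
    have "t > 0" "cball y t \<subseteq> cball y R" using t s by auto
    then have eq: "(\<lambda>x. u x * kern y t x) = (\<lambda>x. v x * kern y t x)"
      using v(2) kern_eq_0[of t _ y] by (fastforce simp: fun_eq_iff)
    have "(LINT x|lebesgue_on UNIV. v x * kern y t x) = A t"
      unfolding A_def
      by (rule lebesgue_on_compact_support(2)[OF _ _ subset_UNIV order_trans[OF \<open>cball y t \<subseteq> cball y R\<close> c]])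
        (use \<open>t > 0\<close> kern_eq_0 v(1) in \<open>auto intro!: continuous_intros continuous_on_kern\<close>)
    then show ?thesis by (simp add: kern_mean_def eq lebesgue_on_UNIV_eq)
  qed
  define A' where "A' t = integral (cbox (- c) c) (\<lambda>x. v x * (laplacian (barrier y t) x * t / (2 * t ^ CARD('n))))" for t
  have A': "(A has_real_derivative A' t) (at t within {s..R})" if "t \<in> {s..R}" for t
    unfolding A_def[abs_def] A'_def
  proof (rule leibniz_rule_field_derivative[where f = "\<lambda>t x. v x * kern y t x"
        and fx = "\<lambda>t x. v x * (laplacian (barrier y t) x * t / (2 * t ^ CARD('n)))"])
    show "((\<lambda>t. v x * kern y t x) has_field_derivative v x * (laplacian (barrier y t) x * t / (2 * t ^ CARD('n))))
        (at t within {s..R})" if "t \<in> {s..R}" for t x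
      using that s by (intro DERIV_cmult has_field_derivative_at_within[OF has_real_derivative_kern]) auto
    show "(\<lambda>x. v x * kern y t x) integrable_on cbox (- c) c" if "t \<in> {s..R}" for t
      using that s by (intro integrable_continuous continuous_intros continuous_on_kern continuous_on_subset[OF v(1)]) auto
    have "continuous_on ({s..R} \<times> cbox (- c) c) (\<lambda>(t, x). laplacian (barrier y t) x)"
      by (rule continuous_on_subset[OF continuous_on_laplacian_barrier]) (use s in auto)
    then show "continuous_on ({s..R} \<times> cbox (- c) c)
        (\<lambda>(t, x). v x * (laplacian (barrier y t) x * t / (2 * t ^ CARD('n))))"
      unfolding case_prod_unfold
      by (intro continuous_intros continuous_on_compose2[OF v(1)]) (use s in auto)
  qed (use that in auto)
  have "\<bar>A' t\<bar> \<le> B / 2" if t: "t \<in> {s..R}" for t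
  proof -
    have "t > 0" "cball y t \<subseteq> cball y R" using t s by auto
    have eq: "(\<lambda>x. u x * laplacian (barrier y t) x) = (\<lambda>x. v x * laplacian (barrier y t) x)"
      using v(2) laplacian_barrier_eq_0[OF \<open>t > 0\<close>, of _ y] \<open>cball y t \<subseteq> cball y R\<close>
      by (fastforce simp: fun_eq_iff)
    have cont: "continuous_on UNIV (\<lambda>x. laplacian (barrier y t) x)"
    proof -
      have "continuous_on UNIV (\<lambda>x :: real ^ 'n. (t, x))"
        by (intro continuous_on_Pair continuous_on_const continuous_on_id)
      from continuous_on_compose2[OF continuous_on_laplacian_barrier[of y] this] \<open>t > 0\<close>
      show ?thesis by auto
    qed
    have "(LINT x|lebesgue_on (ball y (4 / 3 * t)). v x * laplacian (barrier y t) x)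
        = integral (cbox (- c) c) (\<lambda>x. v x * laplacian (barrier y t) x)"
      by (rule lebesgue_on_compact_support(2)[OF _ _ _ order_trans[OF \<open>cball y t \<subseteq> cball y R\<close> c]])
        (use \<open>t > 0\<close> laplacian_barrier_eq_0 v(1) cont in \<open>auto intro!: continuous_intros\<close>)
    then have "\<bar>integral (cbox (- c) c) (\<lambda>x. v x * laplacian (barrier y t) x)\<bar> \<le> B * t ^ CARD('n) / t"
      using lap[OF t] by (simp add: eq)
    moreover have "A' t = t / (2 * t ^ CARD('n)) * integral (cbox (- c) c) (\<lambda>x. v x * laplacian (barrier y t) x)"
      unfolding A'_def by (subst integral_mult_right[symmetric]) (simp add: mult_ac)
    ultimately have "\<bar>A' t\<bar> \<le> t / (2 * t ^ CARD('n)) * (B * t ^ CARD('n) / t)"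
      using \<open>t > 0\<close> by (simp add: abs_mult del: times_divide_eq_left times_divide_eq_right)
    also have "\<dots> = B / 2" using \<open>t > 0\<close> by simp
    finally show ?thesis .
  qed
  then have "norm (A R - A s) \<le> B / 2 * norm (R - s)"
    using s by (intro field_differentiable_bound[OF convex_real_interval(5) A']) auto
  then show ?thesis using A s by simp
qed

lemma measure_ball_vec:
  "r \<ge> 0 \<Longrightarrow> measure lebesgue (ball y r) = unit_ball_vol CARD('n) * r ^ CARD('n)" for y :: "real ^ 'n::finite"
  using content_ball[of r y] by simp

lemma measure_cball_vec:
  "r \<ge> 0 \<Longrightarrow> measure lebesgue (cball y r) = unit_ball_vol CARD('n) * r ^ CARD('n)" for y :: "real ^ 'n::finite"
  using content_cball[of r y] by simp

lemma kern_mean_le: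
  fixes u :: "real ^ 'n::finite \<Rightarrow> real"
  assumes u: "continuous_on (cball y r) u" and "r > 0" "e \<ge> 0" and le: "\<And>x. x \<in> cball y r \<Longrightarrow> u x \<le> e"
  shows "kern_mean u y r \<le> 6 * unit_ball_vol CARD('n) * e"
proof -
  have int: "integrable lebesgue (\<lambda>x. (e * (6 / r ^ CARD('n))) * indicator (cball y r) x)"
    using emeasure_lborel_cball_finite[of y r]
    by (intro integrable_mult_right integrable_real_indicator) auto
  have "kern_mean u y r \<le> (LINT x|lebesgue. (e * (6 / r ^ CARD('n))) * indicator (cball y r) x)"
    unfolding kern_mean_def
  proof (rule integral_mono[OF kern_mean_integrable[OF u \<open>r > 0\<close>] int])
    fix x
    have "u x * kern y r x \<le> e * (6 / r ^ CARD('n))" if "x \<in> cball y r"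
      using that assms by (intro mult_mono le kern_le kern_nonneg) auto
    then show "u x * kern y r x \<le> (e * (6 / r ^ CARD('n))) * indicator (cball y r) x"
      using kern_eq_0[OF \<open>r > 0\<close>, of x y] by (cases "x \<in> cball y r") auto
  qed
  also have "\<dots> = 6 * unit_ball_vol CARD('n) * e"
    using \<open>r > 0\<close> measure_cball_vec[of r y] by simp
  finally show ?thesis .
qed

text \<open>Only the ball of half the radius is kept, where the kernel is at least exp (- 4) / r^n;
  its volume accounts for the factor 2^n.\<close>

lemma kern_mean_ge:
  fixes u :: "real ^ 'n::finite \<Rightarrow> real"
  assumes u: "continuous_on (cball y r) u" and "r > 0" "l \<ge> 0" and ge: "\<And>x. x \<in> cball y r \<Longrightarrow> l \<le> u x"
  shows "unit_ball_vol CARD('n) * exp (- 4) / 2 ^ CARD('n) * l \<le> kern_mean u y r"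
proof -
  have int: "integrable lebesgue (\<lambda>x. (l * (exp (- 4) / r ^ CARD('n))) * indicator (cball y (r / 2)) x)"
    using emeasure_lborel_cball_finite[of y "r / 2"]
    by (intro integrable_mult_right integrable_real_indicator) auto
  have "unit_ball_vol CARD('n) * exp (- 4) / 2 ^ CARD('n) * l =
      (LINT x|lebesgue. (l * (exp (- 4) / r ^ CARD('n))) * indicator (cball y (r / 2)) x)"
    using \<open>r > 0\<close> measure_cball_vec[of "r / 2" y] by (simp add: power_divide)
  also have "\<dots> \<le> kern_mean u y r"
    unfolding kern_mean_def
  proof (rule integral_mono[OF int kern_mean_integrable[OF u \<open>r > 0\<close>]])
    fix x
    have "l * (exp (- 4) / r ^ CARD('n)) \<le> u x * kern y r x" if "x \<in> cball y (r / 2)"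
      using that assms
      by (intro mult_mono ge kern_ge order_trans[OF \<open>l \<ge> 0\<close> ge])
        (auto simp: dist_norm norm_minus_commute)
    moreover have "0 \<le> u x * kern y r x"
      using kern_nonneg[OF \<open>r > 0\<close>, of y x] kern_eq_0[OF \<open>r > 0\<close>, of x y] ge[of x] \<open>l \<ge> 0\<close>
      by (cases "x \<in> cball y r") auto
    ultimately show "(l * (exp (- 4) / r ^ CARD('n))) * indicator (cball y (r / 2)) x \<le> u x * kern y r x"
      by (cases "x \<in> cball y (r / 2)") auto
  qed
  finally show ?thesis .
qed

section \<open>Linear growth at the free boundary\<close>

lemma barrier_scaled_test_function:
  assumes "0 < r" "r < \<rho>"
  shows "(\<lambda>x. c * barrier y r x) \<in> test_functions (ball y \<rho>)"
proof (rule test_functionsI[where K = "cball y r"])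
  show "(\<lambda>x. c * barrier y r x) \<in> smooth"
    by (intro smooth_mult smooth_const smooth_barrier)
  show "c * barrier y r x = 0" if "x \<notin> cball y r" for x
    using profile_le_0[OF \<open>0 < r\<close> that] by (simp add: barrier_def bump_eq_0_iff)
qed (use assms in auto)

lemma partial_deriv_cmult:
  "f \<in> smooth \<Longrightarrow> partial_deriv i (\<lambda>x. c * f x) = (\<lambda>x. c * partial_deriv i f x)"
  by (rule ext)
    (simp add: partial_deriv_mult[OF smooth_differentiable[OF smooth_const] smooth_differentiable] partial_deriv_const)

lemma laplacian_cmult:
  "f \<in> smooth \<Longrightarrow> laplacian (\<lambda>x. c * f x) x = c * laplacian f x"
  by (simp add: laplacian_def partial_deriv_cmult smooth_partial_deriv sum_distrib_left)

text \<open>The gradient has length at most (2 / r^2) 6 r = 12 / r.\<close>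

lemma gradient_barrier_le:
  fixes y :: "real ^ 'n::finite"
  assumes "r > 0"
  shows "(\<Sum>i\<in>UNIV. (partial_deriv i (barrier y r) x)\<^sup>2) \<le> 144 / r\<^sup>2"
proof -
  have "(\<Sum>i\<in>UNIV. (partial_deriv i (barrier y r) x)\<^sup>2) =
      (2 / r\<^sup>2 * bump 2 (profile y r x))\<^sup>2 * (norm (x - y))\<^sup>2"
  proof -
    have "(- 2 / r\<^sup>2 * a * b)\<^sup>2 = (2 / r\<^sup>2 * b)\<^sup>2 * a\<^sup>2" for a b :: real
      by (simp add: power2_eq_square)
    then show ?thesis
      by (simp only: partial_deriv_barrier norm_vec_power2 sum_distrib_left vector_minus_component)
  qed
  also have "\<dots> \<le> 144 / r\<^sup>2"
  proof (cases "x \<in> cball y r")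
    case True
    then have "(norm (x - y))\<^sup>2 \<le> r\<^sup>2"
      by (intro power_mono) (auto simp: dist_norm norm_minus_commute)
    moreover have "(2 / r\<^sup>2 * bump 2 (profile y r x))\<^sup>2 \<le> (2 / r\<^sup>2 * 6)\<^sup>2"
      using bump_2_le[OF profile_le_1] by (intro power_mono mult_left_mono) (auto simp: bump_nonneg)
    ultimately have "(2 / r\<^sup>2 * bump 2 (profile y r x))\<^sup>2 * (norm (x - y))\<^sup>2 \<le> (2 / r\<^sup>2 * 6)\<^sup>2 * r\<^sup>2"
      by (intro mult_mono) auto
    also have "\<dots> = 144 / r\<^sup>2"
      using assms by (simp add: power2_eq_square)
    finally show ?thesis .
  next
    case False
    then have "bump 2 (profile y r x) = 0"
      using profile_le_0[OF assms] by (simp add: bump_eq_0_iff)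
    then show ?thesis by simp
  qed
  finally show ?thesis .
qed

text \<open>Testing minimality with \<open>u \<plusminus> c \<Psi>\<close>, where \<open>\<Psi>\<close> is the barrier, gives
  \<open>\<bar>c I\<bar> \<le> (72 c\<^sup>2 / r\<^sup>2 + 2 m\<^sup>2) \<bar>ball y \<rho>\<bar>\<close> for \<open>I = \<integral> u \<Delta>\<Psi>\<close>; the choice \<open>c = m r / 6\<close> is optimal.\<close>

lemma local_minimizer_laplacian_barrier:
  fixes u :: "real ^ 'n::finite \<Rightarrow> real"
  assumes min: "local_minimizer \<sigma> \<Omega>\<^sub>0 u" and \<sigma>: "\<sigma> \<in> borel_measurable borel" "\<And>t. \<bar>\<sigma> t\<bar> \<le> m\<^sup>2"
    and \<Omega>: "open \<Omega>\<^sub>0" "ball y \<rho> \<subseteq> \<Omega>\<^sub>0" and r: "0 < r" "r < \<rho>" and "m > 0"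
  shows "\<bar>LINT x|lebesgue_on (ball y \<rho>). u x * laplacian (barrier y r) x\<bar> \<le>
    24 * m * measure lebesgue (ball y \<rho>) / r"
proof -
  let ?I = "LINT x|lebesgue_on (ball y \<rho>). u x * laplacian (barrier y r) x"
  let ?\<mu> = "measure lebesgue (ball y \<rho>)"
  have *: "c * ?I \<le> (72 * c\<^sup>2 / r\<^sup>2 + 2 * m\<^sup>2) * ?\<mu>" for c
  proof -
    note \<psi> = barrier_scaled_test_function[OF r, of c y]
    have "c * ?I = (LINT x|lebesgue_on (ball y \<rho>). u x * laplacian (\<lambda>x. c * barrier y r x) x)"
      by (simp add: laplacian_cmult[OF smooth_barrier] mult_ac flip: integral_mult_right_zero)
    also have "\<dots> \<le> 1 / 2 * (LINT x|lebesgue_on (ball y \<rho>).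
        (\<Sum>i\<in>UNIV. (partial_deriv i (\<lambda>x. c * barrier y r x) x)\<^sup>2)) + 2 * m\<^sup>2 * ?\<mu>"
      by (rule local_minimizer_laplacian_le[OF min \<sigma> \<Omega>(1) open_ball \<Omega>(2) bounded_ball \<psi>])
    also have "(LINT x|lebesgue_on (ball y \<rho>).
        (\<Sum>i\<in>UNIV. (partial_deriv i (\<lambda>x. c * barrier y r x) x)\<^sup>2)) \<le> (144 * c\<^sup>2 / r\<^sup>2) * ?\<mu>"
    proof (rule order_trans[OF abs_ge_self lebesgue_on_bounded_integral(2)])
      show "(\<lambda>x. \<Sum>i\<in>UNIV. (partial_deriv i (\<lambda>x. c * barrier y r x) x)\<^sup>2)
          \<in> borel_measurable (lebesgue_on (ball y \<rho>))"
        by (intro continuous_imp_measurable_on_sets_lebesgue continuous_intros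
            test_functions_continuous[OF test_functions_partial_deriv[OF \<psi>]]) auto
      fix x
      have "(\<Sum>i\<in>UNIV. (partial_deriv i (\<lambda>x. c * barrier y r x) x)\<^sup>2) =
          c\<^sup>2 * (\<Sum>i\<in>UNIV. (partial_deriv i (barrier y r) x)\<^sup>2)"
        by (simp add: partial_deriv_cmult[OF smooth_barrier] power_mult_distrib sum_distrib_left)
      also have "\<dots> \<le> c\<^sup>2 * (144 / r\<^sup>2)"
        using gradient_barrier_le[OF r(1)] by (intro mult_left_mono) auto
      finally show "\<bar>\<Sum>i\<in>UNIV. (partial_deriv i (\<lambda>x. c * barrier y r x) x)\<^sup>2\<bar> \<le> 144 * c\<^sup>2 / r\<^sup>2"
        by (simp add: sum_nonneg mult_ac)
    qed auto
    finally show ?thesis by (simp add: algebra_simps)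
  qed
  \<comment> \<open>At this size of \<open>c\<close> both terms in the parenthesis equal 2 m^2;
    using both signs of \<open>c\<close> bounds the absolute value, and dividing 4 m^2 by m r / 6
    gives 24 m / r.\<close>
  have eq: "(72 * c\<^sup>2 / r\<^sup>2 + 2 * m\<^sup>2) * ?\<mu> = 4 * m\<^sup>2 * ?\<mu>" if "c = m * r / 6 \<or> c = - (m * r / 6)" for c
  proof -
    have "c\<^sup>2 = (m * r / 6)\<^sup>2" using that by (elim disjE) (simp_all only: power2_minus)
    then have "72 * c\<^sup>2 / r\<^sup>2 = 2 * m\<^sup>2" using r by (simp add: power_mult_distrib field_simps)
    then show ?thesis by simp
  qed
  have "m * r / 6 * ?I \<le> 4 * m\<^sup>2 * ?\<mu>" "- (m * r / 6) * ?I \<le> 4 * m\<^sup>2 * ?\<mu>"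
    by (rule order_trans[OF * eq_refl[OF eq]], simp)+
  then have "m * r / 6 * \<bar>?I\<bar> \<le> 4 * m\<^sup>2 * ?\<mu>" by (cases "?I \<ge> 0") simp_all
  then have "m * (r * \<bar>?I\<bar>) \<le> m * (24 * m * ?\<mu>)" by (simp add: power2_eq_square)
  then have "r * \<bar>?I\<bar> \<le> 24 * m * ?\<mu>" using \<open>m > 0\<close> by simp
  then show ?thesis using r by (simp add: field_simps)
qed

text \<open>The bound does not depend on the inner radius \<open>s\<close>, so \<open>s\<close> may
  later be taken as small as continuity of \<open>u\<close> requires.\<close>

lemma local_minimizer_kern_mean_diff_le:
  fixes u :: "real ^ 'n::finite \<Rightarrow> real"
  assumes min: "local_minimizer \<sigma> \<Omega>\<^sub>0 u" and \<sigma>: "\<sigma> \<in> borel_measurable borel" "\<And>t. \<bar>\<sigma> t\<bar> \<le> m\<^sup>2"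
    and u: "continuous_on \<Omega>\<^sub>0 u"
    and \<Omega>: "open \<Omega>\<^sub>0" "ball y (4 / 3 * R) \<subseteq> \<Omega>\<^sub>0" and s: "0 < s" "s \<le> R" and "m > 0"
  shows "\<bar>kern_mean u y R - kern_mean u y s\<bar> \<le> 12 * (4 / 3) ^ CARD('n) * unit_ball_vol CARD('n) * m * R"
proof -
  let ?B = "24 * (4 / 3) ^ CARD('n) * unit_ball_vol CARD('n) * m"
  have "\<bar>kern_mean u y R - kern_mean u y s\<bar> \<le> ?B / 2 * (R - s)"
  proof (rule kern_mean_diff_le[OF _ s])
    have "cball y R \<subseteq> ball y (4 / 3 * R)" using s by auto
    then show "continuous_on (cball y R) u"
      using \<Omega> by (intro continuous_on_subset[OF u]) auto
    fix t assume t: "t \<in> {s..R}"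
    then have "t > 0" "ball y (4 / 3 * t) \<subseteq> ball y (4 / 3 * R)" using s by auto
    then have "\<bar>LINT x|lebesgue_on (ball y (4 / 3 * t)). u x * laplacian (barrier y t) x\<bar>
        \<le> 24 * m * measure lebesgue (ball y (4 / 3 * t)) / t"
      using \<Omega> \<open>m > 0\<close> by (intro local_minimizer_laplacian_barrier[OF min \<sigma>]) auto
    also have "measure lebesgue (ball y (4 / 3 * t)) = unit_ball_vol CARD('n) * (4 / 3 * t) ^ CARD('n)"
      using \<open>t > 0\<close> by (intro measure_ball_vec) auto
    also have "24 * m * (unit_ball_vol CARD('n) * (4 / 3 * t) ^ CARD('n)) / t = ?B * t ^ CARD('n) / t"
      by (simp add: power_mult_distrib power_divide)
    finally show "\<bar>LINT x|lebesgue_on (ball y (4 / 3 * t)). u x * laplacian (barrier y t) x\<bar>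
        \<le> ?B * t ^ CARD('n) / t" .
  qed
  also have "\<dots> \<le> ?B / 2 * R"
    using s \<open>m > 0\<close> by (intro mult_left_mono) auto
  finally show ?thesis by (simp add: mult_ac)
qed

text \<open>Pointwise comparison of the two kernels on the smaller ball; nonnegativity of
  \<open>u\<close> allows the rest of the larger ball to be discarded.\<close>

lemma kern_mean_mono:
  fixes u :: "real ^ 'n::finite \<Rightarrow> real"
  assumes u: "continuous_on (cball x0 (3 / 2 * d)) u" "\<And>z. z \<in> cball x0 (3 / 2 * d) \<Longrightarrow> u z \<ge> 0"
    and d: "d > 0" "norm (x - x0) = d"
  shows "kern_mean u x (d / 4) \<le> 6 * 6 ^ CARD('n) * exp 4 * kern_mean u x0 (3 / 2 * d)"
proof -
  let ?L = "6 * 6 ^ CARD('n) * exp (4 :: real)"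
  have near: "norm (z - x0) \<le> 5 / 6 * (3 / 2 * d)" if "z \<in> cball x (d / 4)" for z
    using norm_triangle_ineq[of "z - x" "x - x0"] that d by (auto simp: dist_norm norm_minus_commute)
  have sub: "cball x (d / 4) \<subseteq> cball x0 (3 / 2 * d)"
  proof
    fix z assume "z \<in> cball x (d / 4)"
    from near[OF this] d show "z \<in> cball x0 (3 / 2 * d)"
      by (simp add: dist_norm norm_minus_commute)
  qed
  have "kern_mean u x (d / 4) \<le> (LINT z|lebesgue. ?L * (u z * kern x0 (3 / 2 * d) z))"
    unfolding kern_mean_def
  proof (rule integral_mono)
    show "integrable lebesgue (\<lambda>z. u z * kern x (d / 4) z)"
      using d by (intro kern_mean_integrable continuous_on_subset[OF u(1) sub]) auto
    show "integrable lebesgue (\<lambda>z. ?L * (u z * kern x0 (3 / 2 * d) z))"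
      using d by (intro integrable_mult_right kern_mean_integrable u(1)) auto
    fix z
    show "u z * kern x (d / 4) z \<le> ?L * (u z * kern x0 (3 / 2 * d) z)"
    proof (cases "z \<in> cball x (d / 4)")
      case True
      have "kern x (d / 4) z \<le> 6 / (d / 4) ^ CARD('n)"
        using d by (intro kern_le) auto
      \<comment> \<open>The radii 3 d / 2 and d / 4 have ratio 6.\<close>
      also have "\<dots> = 6 * 6 ^ CARD('n) / (3 / 2 * d) ^ CARD('n)"
      proof -
        have "(6 :: real) ^ CARD('n) * (d / 4) ^ CARD('n) = (3 / 2 * d) ^ CARD('n)"
          by (simp flip: power_mult_distrib)
        then show ?thesis using d by (simp add: frac_eq_eq)
      qed
      also have "\<dots> = ?L * (exp (- 4) / (3 / 2 * d) ^ CARD('n))"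
        by (simp add: exp_minus)
      also have "\<dots> \<le> ?L * kern x0 (3 / 2 * d) z"
        using d near[OF True] by (intro mult_left_mono kern_ge) auto
      finally have "u z * kern x (d / 4) z \<le> u z * (?L * kern x0 (3 / 2 * d) z)"
        using True sub u(2) by (intro mult_left_mono) auto
      then show ?thesis by (simp add: mult_ac)
    next
      case False
      then have "u z * kern x (d / 4) z = 0"
        using kern_eq_0[of "d / 4" z x] d by simp
      moreover have "0 \<le> u z * kern x0 (3 / 2 * d) z"
        using kern_eq_0[of "3 / 2 * d" z x0] kern_nonneg[of "3 / 2 * d" x0 z] d u(2)[of z]
        by (cases "z \<in> cball x0 (3 / 2 * d)") auto
      then have "0 \<le> ?L * (u z * kern x0 (3 / 2 * d) z)" by (rule mult_nonneg_nonneg[rotated]) simp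
      ultimately show ?thesis by linarith
    qed
  qed
  then show ?thesis by (simp add: kern_mean_def)
qed

text \<open>Read off from the final inequality for \<open>u x / 2\<close>, multiplied by 2 exp 4 2^n
  over the unit ball volume: 18 is 2 times 6 times 3/2 from the average around x0, and 1/2 is 2
  times 1/4 from the passage from scale d / 4 to x. The unit ball volume cancels.\<close>

definition growth_const :: "nat \<Rightarrow> real" where
  "growth_const n = 12 * (4 / 3) ^ n * exp 4 * 2 ^ n * (18 * 6 ^ n * exp 4 + 1 / 2)"

lemma growth_const_pos: "growth_const n > 0"
  by (simp add: growth_const_def add_pos_pos)

lemma local_minimizer_linear_growth:
  fixes u :: "real ^ 'n::finite \<Rightarrow> real"
  assumes min: "local_minimizer \<sigma> \<Omega>\<^sub>0 u" and \<sigma>: "\<sigma> \<in> borel_measurable borel" "\<And>t. \<bar>\<sigma> t\<bar> \<le> m\<^sup>2"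
    and u: "continuous_on \<Omega>\<^sub>0 u" "\<And>z. z \<in> \<Omega>\<^sub>0 \<Longrightarrow> u z \<ge> 0"
    and \<Omega>: "open \<Omega>\<^sub>0" "ball x0 (2 * norm (x - x0)) \<subseteq> \<Omega>\<^sub>0" and x: "x \<noteq> x0" "u x0 = 0" and "m > 0"
  shows "u x \<le> growth_const CARD('n) * m * norm (x - x0)"
proof -
  define d where "d = norm (x - x0)"
  have d: "d > 0" using x by (simp add: d_def)
  let ?\<omega> = "unit_ball_vol CARD('n)"
  define C1 where "C1 = 12 * (4 / 3) ^ CARD('n) * ?\<omega> * m"
  have \<omega>: "?\<omega> > 0" by simp
  then have \<omega>_nz: "?\<omega> \<noteq> 0" by (rule less_imp_neq[THEN not_sym])
  \<comment> \<open>The enlarged ball for scale 3 d / 2 around x0 has radius 4/3 times 3 d / 2, that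
    is 2 d, which accounts for the radius in the hypothesis.\<close>
  have "cball x0 (3 / 2 * d) \<subseteq> ball x0 (2 * d)" using d by (auto simp: cball_subset_ball_iff)
  then have balls: "ball x0 (4 / 3 * (3 / 2 * d)) \<subseteq> \<Omega>\<^sub>0" "cball x0 (3 / 2 * d) \<subseteq> \<Omega>\<^sub>0"
    using \<Omega>(2) by (auto simp: d_def)
  have near: "norm (z - x0) \<le> 4 / 3 * d" if "norm (z - x) \<le> 1 / 3 * d" for z
    using norm_triangle_ineq[of "z - x" "x - x0"] that by (simp add: d_def)
  have balls': "ball x (4 / 3 * (d / 4)) \<subseteq> \<Omega>\<^sub>0"
  proof
    fix z assume "z \<in> ball x (4 / 3 * (d / 4))"
    then have "norm (z - x0) \<le> 4 / 3 * d" by (intro near) (simp add: dist_norm norm_minus_commute)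
    then show "z \<in> \<Omega>\<^sub>0" using balls(1) d by (auto simp: dist_norm norm_minus_commute)
  qed
  \<comment> \<open>Continuity and \<open>u x0 = 0\<close> make the average at a small scale
    \<open>s\<close> at most \<open>e\<close>; the radius-uniform estimate carries this up to scale
    3 d / 2.\<close>
  have at_x0: "kern_mean u x0 (3 / 2 * d) \<le> C1 * (3 / 2 * d)"
  proof (rule field_le_epsilon)
    fix e :: real assume "e > 0"
    define e' where "e' = e / (6 * ?\<omega>)"
    have "e' > 0" using \<open>e > 0\<close> by (simp add: e'_def)
    have "x0 \<in> \<Omega>\<^sub>0" using balls(2) d by auto
    then have "continuous (at x0) u"
      using u(1) \<Omega>(1) by (auto simp: continuous_on_eq_continuous_at)
    then obtain \<delta> where \<delta>: "\<delta> > 0" "\<And>z. dist z x0 < \<delta> \<Longrightarrow> dist (u z) (u x0) < e'"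
      using \<open>e' > 0\<close> unfolding continuous_at_eps_delta by metis
    define s where "s = min (\<delta> / 2) (3 / 2 * d)"
    have s: "0 < s" "s \<le> 3 / 2 * d" "s < \<delta>" using \<delta>(1) d by (auto simp: s_def)
    have "cball x0 s \<subseteq> \<Omega>\<^sub>0" using balls(2) s(2) by (meson order_trans subset_cball)
    then have "kern_mean u x0 s \<le> 6 * ?\<omega> * e'"
      using s \<open>e' > 0\<close> \<delta>(2) x(2)
      by (intro kern_mean_le continuous_on_subset[OF u(1)])
        (auto simp: dist_commute dist_real_def abs_less_iff intro!: less_imp_le)
    also have "\<dots> = e" using \<omega>_nz by (simp add: e'_def)
    finally have "kern_mean u x0 s \<le> e" .
    moreover have "\<bar>kern_mean u x0 (3 / 2 * d) - kern_mean u x0 s\<bar> \<le> C1 * (3 / 2 * d)"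
      unfolding C1_def by (rule local_minimizer_kern_mean_diff_le[OF min \<sigma> u(1) \<Omega>(1) balls(1) s(1,2) \<open>m > 0\<close>])
    ultimately show "kern_mean u x0 (3 / 2 * d) \<le> C1 * (3 / 2 * d) + e" by linarith
  qed
  have "x \<in> \<Omega>\<^sub>0" using balls' d by auto
  have at_x: "?\<omega> * exp (- 4) / 2 ^ CARD('n) * (u x / 2) \<le> kern_mean u x (d / 4) + C1 * (d / 4)"
  proof -
    \<comment> \<open>Instead of letting the scale tend to 0, one fixed scale is used on which
      \<open>u\<close> is at least half its value at \<open>x\<close>, at the price of a factor 2.
      If that value is 0 it cannot serve as a continuity tolerance, and nonnegativity of
      \<open>u\<close> is enough.\<close>
    obtain s where s: "0 < s" "s \<le> d / 4" and ge: "\<And>z. z \<in> cball x s \<Longrightarrow> u x / 2 \<le> u z"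
    proof (cases "u x = 0")
      case True
      have "u x / 2 \<le> u z" if "z \<in> cball x (d / 4)" for z
        using that True u(2) balls' d by (auto simp: subset_eq)
      then show ?thesis using that[of "d / 4"] d by auto
    next
      case False
      then have "u x / 2 > 0" using u(2)[OF \<open>x \<in> \<Omega>\<^sub>0\<close>] by simp
      moreover have "continuous (at x) u"
        using u(1) \<Omega>(1) \<open>x \<in> \<Omega>\<^sub>0\<close> by (auto simp: continuous_on_eq_continuous_at)
      ultimately obtain \<delta> where \<delta>: "\<delta> > 0" "\<And>z. dist z x < \<delta> \<Longrightarrow> dist (u z) (u x) < u x / 2"
        unfolding continuous_at_eps_delta by metis
      show ?thesis
      proof (rule that[of "min (\<delta> / 2) (d / 4)"])
        fix z assume "z \<in> cball x (min (\<delta> / 2) (d / 4))"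
        then have "dist z x < \<delta>" using \<delta>(1) by (auto simp: dist_commute)
        then have "\<bar>u z - u x\<bar> < u x / 2" using \<delta>(2) by (simp add: dist_real_def)
        then show "u x / 2 \<le> u z" by linarith
      qed (use \<delta> d in auto)
    qed
    have "cball x s \<subseteq> ball x (4 / 3 * (d / 4))" using s d by auto
    then have "continuous_on (cball x s) u" using balls' by (intro continuous_on_subset[OF u(1)]) auto
    then have "?\<omega> * exp (- 4) / 2 ^ CARD('n) * (u x / 2) \<le> kern_mean u x s"
      using s(1) ge u(2)[OF \<open>x \<in> \<Omega>\<^sub>0\<close>] by (intro kern_mean_ge) auto
    moreover have "\<bar>kern_mean u x (d / 4) - kern_mean u x s\<bar> \<le> C1 * (d / 4)"
      unfolding C1_def by (rule local_minimizer_kern_mean_diff_le[OF min \<sigma> u(1) \<Omega>(1) balls' s \<open>m > 0\<close>])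
    ultimately show ?thesis by linarith
  qed
  have "kern_mean u x (d / 4) \<le> 6 * 6 ^ CARD('n) * exp 4 * kern_mean u x0 (3 / 2 * d)"
    using u(2) balls(2) d by (intro kern_mean_mono continuous_on_subset[OF u(1)]) (auto simp: d_def)
  also have "\<dots> \<le> 6 * 6 ^ CARD('n) * exp 4 * (C1 * (3 / 2 * d))"
    using at_x0 by (intro mult_left_mono) auto
  finally have "?\<omega> * exp (- 4) / 2 ^ CARD('n) * (u x / 2) \<le>
      6 * 6 ^ CARD('n) * exp 4 * (C1 * (3 / 2 * d)) + C1 * (d / 4)"
    using at_x by linarith
  also have "\<dots> = ?\<omega> * exp (- 4) / 2 ^ CARD('n) * (growth_const CARD('n) * m * d / 2)"
    by (simp add: C1_def growth_const_def exp_minus field_simps)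
  finally have "u x / 2 \<le> growth_const CARD('n) * m * d / 2"
    by (rule mult_left_le_imp_le) (simp add: \<omega>)
  then show ?thesis by (simp add: d_def)
qed

theorem theorem4p1:
  fixes M :: real and \<phi> :: "real ^ 'n::finite \<Rightarrow> real"
  assumes "\<phi> \<in> H1 (ball 0 1)"
    and "ess_bounded (ball 0 1) \<phi>"
    and "AE x in lebesgue_on (ball 0 1). \<phi> x \<ge> 0"
  shows "\<exists>C>0. \<forall>(\<sigma> :: real \<Rightarrow> real) (u :: real ^ 'n \<Rightarrow> real) x0.
    \<sigma> \<in> borel_measurable borel \<and> bounded (range \<sigma>) \<and> sup_norm \<sigma> = M \<and>
    local_minimizer \<sigma> (ball 0 1) u \<and>
    continuous_on (ball 0 1) u \<and>
    (\<forall>x\<in>ball 0 1. u x \<ge> 0) \<and>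
    x0 \<in> frontier {x \<in> ball 0 1. u x > 0} \<inter> ball 0 (1 / 2) \<longrightarrow>
    (\<forall>x\<in>ball x0 (1 / 4).
       \<bar>u x\<bar> \<le> C * (Linf_norm (ball 0 (3 / 4)) u + sqrt (sup_norm \<sigma>)) * norm (x - x0))"
proof (intro exI[of _ "growth_const CARD('n)"] conjI growth_const_pos allI impI ballI; elim conjE IntE)
  fix \<sigma> :: "real \<Rightarrow> real" and u :: "real ^ 'n \<Rightarrow> real" and x0 x
  let ?C = "growth_const CARD('n)"
  assume \<sigma>: "\<sigma> \<in> borel_measurable borel" "bounded (range \<sigma>)"
    and min: "local_minimizer \<sigma> (ball 0 1) u" and u: "continuous_on (ball 0 1) u" "\<forall>x\<in>ball 0 1. u x \<ge> 0"
    and x0: "x0 \<in> frontier {x \<in> ball 0 1. u x > 0}" "x0 \<in> ball 0 (1 / 2)" and x: "x \<in> ball x0 (1 / 4)"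
  \<comment> \<open>The positivity set is open, hence disjoint from its frontier, so
    \<open>u\<close> vanishes at x0.\<close>
  have "open {x \<in> ball 0 1. u x > 0}"
    using continuous_openin_preimage_gen[OF u(1) open_greaterThan[of 0]]
    by (auto simp: openin_open_eq vimage_def Int_def)
  then have "x0 \<notin> {x \<in> ball 0 1. u x > 0}"
    using x0(1) by (simp add: frontier_def interior_open)
  moreover have "x0 \<in> ball 0 1" using x0(2) by simp
  ultimately have u0: "u x0 = 0" using u(2) by (simp add: order_antisym)
  have sup: "\<bar>\<sigma> t\<bar> \<le> sup_norm \<sigma>" for t
    unfolding sup_norm_def using \<sigma>(2)
    by (intro cSUP_upper) (auto simp: bounded_iff bdd_above_def)
  then have sup_nonneg: "sup_norm \<sigma> \<ge> 0" using order_trans[OF abs_ge_zero] by blast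
  have x_norm: "norm (x - x0) < 1 / 4" using x by (simp add: dist_norm norm_minus_commute)
  \<comment> \<open>The radius is below 1/2 because \<open>x\<close> lies within 1/4 of x0, and x0
    itself lies within 1/2 of the origin.\<close>
  have sub: "ball x0 (2 * norm (x - x0)) \<subseteq> ball 0 1"
  proof
    fix z assume "z \<in> ball x0 (2 * norm (x - x0))"
    then show "z \<in> ball 0 1"
      using x0(2) x_norm norm_triangle_ineq[of x0 "z - x0"] by (simp add: dist_norm norm_minus_commute)
  qed
  have "x \<in> ball 0 1"
    using x0(2) x_norm norm_triangle_ineq[of x0 "x - x0"] by (simp add: dist_norm)
  \<comment> \<open>The strict inequality guarantees \<open>m > 0\<close> even when
    \<open>\<sigma>\<close> vanishes identically; the borderline value is recovered by the limit
    from the right.\<close>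
  have le: "u x \<le> ?C * m * norm (x - x0)" if "m > sqrt (sup_norm \<sigma>)" for m
  proof (cases "x = x0")
    case False
    have "m > 0" using that sup_nonneg real_sqrt_ge_zero by (meson le_less_trans)
    have "sup_norm \<sigma> \<le> m\<^sup>2"
      using that \<open>m > 0\<close> sup_nonneg by (simp add: real_le_lsqrt real_sqrt_le_iff sqrt_le_D less_imp_le)
    then show ?thesis
      using u(2) sup order_trans
      by (intro local_minimizer_linear_growth[OF min \<sigma>(1) _ u(1) _ open_ball sub False u0 \<open>m > 0\<close>]) blast+
  qed (simp add: u0)
  have "((\<lambda>m. ?C * m * norm (x - x0)) \<longlongrightarrow> ?C * sqrt (sup_norm \<sigma>) * norm (x - x0))
      (at_right (sqrt (sup_norm \<sigma>)))"
    by (intro tendsto_intros)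
  then have "u x \<le> ?C * sqrt (sup_norm \<sigma>) * norm (x - x0)"
    by (rule tendsto_lowerbound) (auto simp: eventually_at_right_less le intro: eventually_at_rightI[of _ "sqrt (sup_norm \<sigma>) + 1"])
  also have "\<dots> \<le> ?C * (Linf_norm (ball 0 (3 / 4)) u + sqrt (sup_norm \<sigma>)) * norm (x - x0)"
  proof -
    let ?N = "lebesgue_on (ball (0 :: real ^ 'n) (3 / 4))"
    \<comment> \<open>Over a null space the essential supremum of a constant would be minus
      infinity, so positive measure is needed to compare with the constant 0.\<close>
    have "emeasure ?N (space ?N) \<noteq> 0"
      using content_ball_pos[of "3 / 4" "0 :: real ^ 'n"]
      by (auto simp: emeasure_restrict_space measure_def)
    then have "0 = esssup ?N (\<lambda>x. 0)" by (simp add: esssup_const)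
    also have "\<dots> \<le> esssup ?N (\<lambda>x. ereal \<bar>u x\<bar>)" by (intro esssup_mono) auto
    finally have "Linf_norm (ball 0 (3 / 4)) u \<ge> 0"
      by (simp add: Linf_norm_def real_of_ereal_pos)
    then show ?thesis
      using growth_const_pos[of "CARD('n)"] by (intro mult_right_mono mult_left_mono) auto
  qed
  finally show "\<bar>u x\<bar> \<le> ?C * (Linf_norm (ball 0 (3 / 4)) u + sqrt (sup_norm \<sigma>)) * norm (x - x0)"
    using u(2) \<open>x \<in> ball 0 1\<close> by simp
qed

end
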